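(* Let $\Gamma$ be a distance-regular graph of diameter $D \geq 3$ which is one of: (i) a Hamming graph or a Doob graph; (ii) a Johnson graph; (iii) a halved cube; (iv) the Gosset graph. Then the distance matrix of $\Gamma$ has exactly $3$ distinct eigenvalues, one of which is $0$.
   Context: The distance matrix of a connected graph has $(x,y)$-entry equal to the graph distance $d(x,y)$. *)

theory Defs
  imports
    "Graph_Theory.Graph_Theory"
    "Jordan_Normal_Form.Spectral_Radius"
begin

text \<open>
  Finite simple graphs are values of type \<^typ>\<open>'a pair_pre_digraph\<close> satisfying
  \<^const>\<open>pair_graph\<close>: every edge is a pair of opposite arcs. The constant
  \<^term>\<open>connected\<close> below is always the graph-theoretic one, written qualified because it shares
  its base name with the topological one.
\<close>

section \<open>Distance, diameter, distance matrix\<close>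

text \<open>
  All walks are counted, not only paths; the minimum is the same. For vertices in different
  components the value is unspecified.
\<close>

definition graph_dist :: "'a pair_pre_digraph \<Rightarrow> 'a \<Rightarrow> 'a \<Rightarrow> nat" where
  "graph_dist G u v = (LEAST n. \<exists>p. pre_digraph.awalk (with_proj G) u p v \<and> length p = n)"

lemma graph_dist_shortest_path:
  assumes "pair_graph G" "pre_digraph.awalk (with_proj G) u q v"
  shows "wf_digraph.\<mu> (with_proj G) (\<lambda>_. 1) u v = ereal (real (graph_dist G u v))"
proof -
  interpret pair_graph G by fact
  have cost: "awalk_cost (\<lambda>_. 1) p = real (length p)" for p :: "('a \<times> 'a) awalk"
    by (induct p) auto
  have "\<exists>n p. awalk u p v \<and> length p = n" using assms(2) by blast
  then have "\<exists>p. awalk u p v \<and> length p = graph_dist G u v"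
    unfolding graph_dist_def by (rule LeastI_ex)
  then obtain p where p: "awalk u p v" "length p = graph_dist G u v" by blast
  have min: "graph_dist G u v \<le> length r" if "awalk u r v" for r
    unfolding graph_dist_def using that by (blast intro: Least_le)
  show ?thesis
    unfolding \<mu>_def cost
  proof (rule antisym)
    show "(INF r\<in>{r. awalk u r v}. ereal (real (length r))) \<le> ereal (real (graph_dist G u v))"
      using p by (intro INF_lower2[of p]) auto
    show "ereal (real (graph_dist G u v)) \<le> (INF r\<in>{r. awalk u r v}. ereal (real (length r)))"
      using min by (intro INF_greatest) auto
  qed
qed

definition graph_diameter :: "'a pair_pre_digraph \<Rightarrow> nat" where
  "graph_diameter G = Max {graph_dist G u v | u v. u \<in> pverts G \<and> v \<in> pverts G}"

text \<open>
  Rows and columns are indexed through an enumeration \<open>vs\<close> of the vertices without repetition.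
  The entries are taken in the complex numbers, so that the spectrum comprises all roots of the
  characteristic polynomial.
\<close>

definition distance_matrix :: "'a pair_pre_digraph \<Rightarrow> 'a list \<Rightarrow> complex mat" where
  "distance_matrix G vs =
     mat (length vs) (length vs) (\<lambda>(i, j). of_nat (graph_dist G (vs ! i) (vs ! j)))"

section \<open>Distance-regular graphs\<close>

text \<open>
  \<open>b\<close> and \<open>c\<close> form the intersection array: for vertices \<open>x\<close>, \<open>y\<close> at distance \<open>i\<close>, the vertex \<open>y\<close>
  has \<open>b i\<close> neighbours at distance \<open>i + 1\<close> from \<open>x\<close> and \<open>c i\<close> neighbours at distance \<open>i - 1\<close>.
\<close>

definition distance_regular :: "'a pair_pre_digraph \<Rightarrow> bool" where
  "distance_regular G \<longleftrightarrow>
     pair_graph G \<and> Digraph_Component.connected (with_proj G) \<and>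
     (\<exists>b c :: nat \<Rightarrow> nat. \<forall>x\<in>pverts G. \<forall>y\<in>pverts G.
        card {z. (y, z) \<in> parcs G \<and> graph_dist G x z = graph_dist G x y + 1}
          = b (graph_dist G x y) \<and>
        card {z. (y, z) \<in> parcs G \<and> graph_dist G x z + 1 = graph_dist G x y}
          = c (graph_dist G x y))"

section \<open>The families\<close>

definition graph_on :: "'a set \<Rightarrow> ('a \<Rightarrow> 'a \<Rightarrow> bool) \<Rightarrow> 'a pair_pre_digraph" where
  "graph_on V adj = \<lparr> pverts = V, parcs = {(x, y). x \<in> V \<and> y \<in> V \<and> adj x y} \<rparr>"

definition graph_iso :: "'a pair_pre_digraph \<Rightarrow> 'b pair_pre_digraph \<Rightarrow> bool" where
  "graph_iso G H \<longleftrightarrow> digraph_iso (with_proj G) (with_proj H)"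

text \<open>
  The parameters of the Hamming graphs, Johnson graphs and halved cubes are not restricted to the
  usual ranges: each such graph with parameters outside them is empty or a single vertex.
\<close>

definition words :: "nat \<Rightarrow> nat \<Rightarrow> nat list set" where
  "words d q = {xs. length xs = d \<and> set xs \<subseteq> {0..<q}}"

definition hamming_dist :: "'a list \<Rightarrow> 'a list \<Rightarrow> nat" where
  "hamming_dist xs ys = card {i. i < length xs \<and> xs ! i \<noteq> ys ! i}"

definition hamming_graph :: "nat \<Rightarrow> nat \<Rightarrow> nat list pair_pre_digraph" where
  "hamming_graph d q = graph_on (words d q) (\<lambda>x y. hamming_dist x y = 1)"

definition is_hamming_graph :: "'a pair_pre_digraph \<Rightarrow> bool" where
  "is_hamming_graph G \<longleftrightarrow> (\<exists>d q. graph_iso G (hamming_graph d q))"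

definition cartesian_product ::
  "'a pair_pre_digraph \<Rightarrow> 'b pair_pre_digraph \<Rightarrow> ('a \<times> 'b) pair_pre_digraph" where
  "cartesian_product G H = graph_on (pverts G \<times> pverts H)
     (\<lambda>(g, h) (g', h'). (g, g') \<in> parcs G \<and> h = h' \<or> g = g' \<and> (h, h') \<in> parcs H)"

definition cartesian_power :: "'a pair_pre_digraph \<Rightarrow> nat \<Rightarrow> 'a list pair_pre_digraph" where
  "cartesian_power G n = graph_on {xs. length xs = n \<and> set xs \<subseteq> pverts G}
     (\<lambda>x y. \<exists>i<n. (x ! i, y ! i) \<in> parcs G \<and> (\<forall>j<n. j \<noteq> i \<longrightarrow> x ! j = y ! j))"

definition complete_graph :: "nat \<Rightarrow> nat pair_pre_digraph" where
  "complete_graph n = graph_on {0..<n} (\<noteq>)"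

text \<open>
  The Cayley graph of the square of the cyclic group of order 4 with connection set
  \<open>{\<plusminus>(1,0), \<plusminus>(0,1), \<plusminus>(1,1)}\<close>.
\<close>

definition shrikhande_graph :: "(int \<times> int) pair_pre_digraph" where
  "shrikhande_graph = graph_on ({0..<4} \<times> {0..<4})
     (\<lambda>(a, b) (c, d). ((a - c) mod 4, (b - d) mod 4)
        \<in> {(1, 0), (3, 0), (0, 1), (0, 3), (1, 1), (3, 3)})"

text \<open>
  At least one Shrikhande factor is required, possibly no factor that is complete on 4 vertices.
\<close>

definition doob_graph :: "nat \<Rightarrow> nat \<Rightarrow> ((int \<times> int) list \<times> nat list) pair_pre_digraph" where
  "doob_graph n m = cartesian_product
     (cartesian_power shrikhande_graph n) (cartesian_power (complete_graph 4) m)"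

definition is_doob_graph :: "'a pair_pre_digraph \<Rightarrow> bool" where
  "is_doob_graph G \<longleftrightarrow> (\<exists>n m. n \<ge> 1 \<and> graph_iso G (doob_graph n m))"

text \<open>Writing \<open>+ 1\<close> on the left keeps the degenerate case \<open>k = 0\<close> free of loops.\<close>

definition johnson_graph :: "nat \<Rightarrow> nat \<Rightarrow> nat set pair_pre_digraph" where
  "johnson_graph n k = graph_on {A. A \<subseteq> {0..<n} \<and> card A = k} (\<lambda>A B. card (A \<inter> B) + 1 = k)"

definition is_johnson_graph :: "'a pair_pre_digraph \<Rightarrow> bool" where
  "is_johnson_graph G \<longleftrightarrow> (\<exists>n k. graph_iso G (johnson_graph n k))"

text \<open>
  The bipartition class of the binary words of even weight in the \<open>n\<close>-cube, two of them being
  adjacent when they are at distance 2 in the cube.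
\<close>

definition halved_cube :: "nat \<Rightarrow> nat list pair_pre_digraph" where
  "halved_cube n = graph_on {x \<in> words n 2. even (sum_list x)} (\<lambda>x y. hamming_dist x y = 2)"

definition is_halved_cube :: "'a pair_pre_digraph \<Rightarrow> bool" where
  "is_halved_cube G \<longleftrightarrow> (\<exists>n. graph_iso G (halved_cube n))"

text \<open>
  The 56 vertices are two copies, told apart by the Boolean, of the 28 edges of the complete graph
  on 8 points. Edges in the same copy are adjacent when they share exactly one point, edges in
  different copies when they are disjoint. In coordinates: an edge \<open>e\<close> in one copy is the vector
  of length 8 with entries 3 on \<open>e\<close> and -1 elsewhere, in the other copy the negative of that
  vector, and adjacency means inner product 8.
\<close>

definition gosset_graph :: "(bool \<times> nat set) pair_pre_digraph" where
  "gosset_graph = graph_on (UNIV \<times> {e. e \<subseteq> {0..<8} \<and> card e = 2})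
     (\<lambda>(s, e) (t, f). if s = t then card (e \<inter> f) = 1 else e \<inter> f = {})"

definition is_gosset_graph :: "'a pair_pre_digraph \<Rightarrow> bool" where
  "is_gosset_graph G \<longleftrightarrow> graph_iso G gosset_graph"

end

theory Submission
  imports Defs
begin

text \<open>
  In each family the distance matrix \<open>D\<close> has constant row sums \<open>r\<close> and satisfies \<open>D\<^sup>2 = c J - t D\<close>
  with \<open>t > 0\<close>, where \<open>J\<close> is the all-ones matrix. Hence its spectrum is contained in
  \<open>{r, 0, - t}\<close>, with equality as soon as two different distances occur. The relation with
  \<open>t / N\<close> fixed, for \<open>N\<close> the number of vertices, is inherited by Cartesian products, and the ratio is
  \<open>1 / 4\<close> both for the Shrikhande graph and for the complete graph on 4 vertices. For halved cubes it
  follows from the orthogonality of the coordinate characters, for Johnson graphs from counting the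
  sets that contain one or two given points, and the distances of the Gosset graph are
  expressed through those of \<open>J(8,2)\<close>.
\<close>

section \<open>Recognizing the distance function\<close>

text \<open>The relation holds because in every family the distance is a constant minus an inner
  product of vectors that sum to zero over the vertices and whose Gram matrix is a multiple of a
  projection. In matrix form \<open>D = (r / N) J - t P\<close>, where the projection
  \<open>P\<close> annihilates the constants; the eigenvalues can be read off from this. Applying
  the quadratic relation to the constant vector forces \<open>c = r (r + t) / N\<close>, which is
  the source of the numerical constants in the concrete cases. Two obstacles shape the argument.
  Graph distance is a minimum over walks, so in each model it must first be replaced by a closed
  formula, recognized by conditions on single arcs. And the parameters of the families are
  unrestricted, so degenerate members have to be excluded; a pair of vertices at distance at least 3
  does this before the relation is established.\<close>

definition geodesic :: "'a pair_pre_digraph \<Rightarrow> ('a \<Rightarrow> 'a \<Rightarrow> nat) \<Rightarrow> bool" where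
  "geodesic G f \<longleftrightarrow> parcs G \<subseteq> pverts G \<times> pverts G \<and>
     (\<forall>x\<in>pverts G. \<forall>y\<in>pverts G. f x y = 0 \<longleftrightarrow> x = y) \<and>
     (\<forall>y\<in>pverts G. \<forall>x z. (x, z) \<in> parcs G \<longrightarrow> f x y \<le> f z y + 1) \<and>
     (\<forall>x\<in>pverts G. \<forall>y\<in>pverts G. \<forall>k. f x y = Suc k \<longrightarrow> (\<exists>z. (x, z) \<in> parcs G \<and> f z y = k))"

lemma geodesicI:
  assumes "parcs G \<subseteq> pverts G \<times> pverts G"
    and "\<And>x y. x \<in> pverts G \<Longrightarrow> y \<in> pverts G \<Longrightarrow> f x y = 0 \<longleftrightarrow> x = y"
    and "\<And>x y z. y \<in> pverts G \<Longrightarrow> (x, z) \<in> parcs G \<Longrightarrow> f x y \<le> f z y + 1"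
    and "\<And>x y k. x \<in> pverts G \<Longrightarrow> y \<in> pverts G \<Longrightarrow> f x y = Suc k \<Longrightarrow>
           \<exists>z. (x, z) \<in> parcs G \<and> f z y = k"
  shows "geodesic G f"
  unfolding geodesic_def by (intro conjI ballI allI impI assms)

lemma geodesicD:
  assumes "geodesic G f"
  shows "parcs G \<subseteq> pverts G \<times> pverts G"
    and "x \<in> pverts G \<Longrightarrow> y \<in> pverts G \<Longrightarrow> f x y = 0 \<longleftrightarrow> x = y"
    and "y \<in> pverts G \<Longrightarrow> (x, z) \<in> parcs G \<Longrightarrow> f x y \<le> f z y + 1"
    and "x \<in> pverts G \<Longrightarrow> y \<in> pverts G \<Longrightarrow> f x y = Suc k \<Longrightarrow>
           \<exists>z. (x, z) \<in> parcs G \<and> f z y = k"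
  using assms unfolding geodesic_def by simp_all

text \<open>The value \<open>f _ y\<close> acts as a potential. It drops by at most 1 along an arc,
  so a walk to \<open>y\<close> has at least \<open>f x y\<close> arcs; and from a positive value
  some arc lowers it by exactly 1, so descending produces a walk of that length.\<close>

lemma geodesic_graph_dist:
  assumes f: "geodesic G f" and x: "x \<in> pverts G" and y: "y \<in> pverts G"
  shows "graph_dist G x y = f x y"
proof -
  note D = geodesicD[OF f]
  have walk: "pre_digraph.awalk (with_proj G) u p v \<longleftrightarrow> u \<in> pverts G \<and> set p \<subseteq> parcs G \<and> pcas u p v"
    for u p v
    by (simp add: pre_digraph.awalk_def cas_with_proj_eq)
  have lower: "f u y \<le> length p"
    if "u \<in> pverts G" "set p \<subseteq> parcs G" "pcas u p y" for u p
    using that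
  proof (induction p arbitrary: u)
    case Nil
    then show ?case using D(2) y by simp
  next
    case (Cons a p)
    obtain w where a: "a = (u, w)" using Cons.prems by (cases a) auto
    then have "w \<in> pverts G" "(u, w) \<in> parcs G" using Cons.prems D(1) by auto
    then show ?case using Cons.IH[of w] Cons.prems a D(3)[OF y, of u w] by auto
  qed
  have upper: "\<exists>p. set p \<subseteq> parcs G \<and> pcas u p y \<and> length p = k"
    if "u \<in> pverts G" "f u y = k" for u k
    using that
  proof (induction k arbitrary: u)
    case 0
    then show ?case using D(2) y by (intro exI[of _ "[]"]) auto
  next
    case (Suc k)
    then obtain w where w: "(u, w) \<in> parcs G" "f w y = k" using D(4) y by blast
    then obtain p where "set p \<subseteq> parcs G" "pcas w p y" "length p = k"
      using Suc.IH[of w] D(1) by auto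
    then show ?case using w by (intro exI[of _ "(u, w) # p"]) auto
  qed
  show ?thesis
    unfolding graph_dist_def walk
    using x lower upper[OF x refl] by (intro Least_equality) auto
qed

text \<open>A digraph isomorphism has separate maps for vertices, arcs, tails and heads. Both graphs
  use the projections as tail and head, so the arc map must be the vertex map applied to both
  components.\<close>

lemma graph_iso_bij:
  assumes "graph_iso G H"
  obtains \<phi> where "bij_betw \<phi> (pverts G) (pverts H)"
    and "\<And>x y. x \<in> pverts G \<Longrightarrow> y \<in> pverts G \<Longrightarrow> (x, y) \<in> parcs G \<longleftrightarrow> (\<phi> x, \<phi> y) \<in> parcs H"
    and "parcs G \<subseteq> pverts G \<times> pverts G"
proof -
  obtain h where h: "pre_digraph.digraph_isomorphism (with_proj G) h"
    and H: "with_proj H = app_iso h (with_proj G)"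
    using assms unfolding graph_iso_def digraph_iso_def by blast
  let ?\<phi> = "iso_verts h"
  have wf: "wf_digraph (with_proj G)" and inj: "inj_on ?\<phi> (pverts G)"
    and ends: "\<And>a. a \<in> parcs G \<Longrightarrow>
      ?\<phi> (fst a) = iso_tail h (iso_arcs h a) \<and> ?\<phi> (snd a) = iso_head h (iso_arcs h a)"
    using h by (simp_all add: pre_digraph.digraph_isomorphism_def)
  have sub: "parcs G \<subseteq> pverts G \<times> pverts G"
    using wf_digraph.head_in_verts[OF wf] wf_digraph.tail_in_verts[OF wf] by force
  have V: "pverts H = ?\<phi> ` pverts G" and E: "parcs H = iso_arcs h ` parcs G"
    and T: "iso_tail h = fst" "iso_head h = snd"
    using arg_cong[OF H, of verts] arg_cong[OF H, of arcs] arg_cong[OF H, of tail]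
      arg_cong[OF H, of head] by simp_all
  have arc: "iso_arcs h (x, y) = (?\<phi> x, ?\<phi> y)" if "(x, y) \<in> parcs G" for x y
    using ends[OF that] T by (simp add: prod_eq_iff)
  have iff: "(x, y) \<in> parcs G \<longleftrightarrow> (?\<phi> x, ?\<phi> y) \<in> parcs H" if "x \<in> pverts G" "y \<in> pverts G" for x y
  proof
    show "(?\<phi> x, ?\<phi> y) \<in> parcs H" if "(x, y) \<in> parcs G"
      using arc[OF that] that E by force
    assume "(?\<phi> x, ?\<phi> y) \<in> parcs H"
    then obtain u v where uv: "(u, v) \<in> parcs G" "(?\<phi> x, ?\<phi> y) = (?\<phi> u, ?\<phi> v)"
      using E arc by auto
    then have "x = u" "y = v" using inj sub that by (auto dest: inj_onD)
    then show "(x, y) \<in> parcs G" using uv by simp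
  qed
  show thesis
    by (rule that[of ?\<phi>]) (use inj V iff sub in \<open>auto simp: bij_betw_def\<close>)
qed

lemma geodesic_iso:
  assumes f: "geodesic H f" and bij: "bij_betw \<phi> (pverts G) (pverts H)"
    and arcs: "\<And>x y. x \<in> pverts G \<Longrightarrow> y \<in> pverts G \<Longrightarrow> (x, y) \<in> parcs G \<longleftrightarrow> (\<phi> x, \<phi> y) \<in> parcs H"
    and sub: "parcs G \<subseteq> pverts G \<times> pverts G"
  shows "geodesic G (\<lambda>x y. f (\<phi> x) (\<phi> y))"
proof (rule geodesicI[OF sub])
  note D = geodesicD[OF f]
  have in_H: "\<phi> x \<in> pverts H" if "x \<in> pverts G" for x
    using bij that by (auto simp: bij_betw_def)
  show "f (\<phi> x) (\<phi> y) = 0 \<longleftrightarrow> x = y" if "x \<in> pverts G" "y \<in> pverts G" for x y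
    using D(2)[OF in_H in_H, OF that] bij that by (auto simp: bij_betw_def dest: inj_onD)
  show "f (\<phi> x) (\<phi> y) \<le> f (\<phi> z) (\<phi> y) + 1" if "y \<in> pverts G" "(x, z) \<in> parcs G" for x y z
    using D(3)[OF in_H] that arcs sub by auto
  show "\<exists>z. (x, z) \<in> parcs G \<and> f (\<phi> z) (\<phi> y) = k"
    if xy: "x \<in> pverts G" "y \<in> pverts G" and k: "f (\<phi> x) (\<phi> y) = Suc k" for x y k
  proof -
    obtain w where w: "(\<phi> x, w) \<in> parcs H" "f w (\<phi> y) = k"
      using D(4)[OF in_H in_H k] xy by blast
    then obtain z where "z \<in> pverts G" "w = \<phi> z"
      using D(1) bij by (auto simp: bij_betw_def)
    then show ?thesis using w arcs xy by blast
  qed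
qed

section \<open>Metrics whose distance matrix satisfies a quadratic equation\<close>

text \<open>
  The factor \<open>card V\<close> makes \<open>\<theta>\<close> invariant under Cartesian products.
\<close>

definition quadratic_metric :: "'a set \<Rightarrow> ('a \<Rightarrow> 'a \<Rightarrow> nat) \<Rightarrow> real \<Rightarrow> bool" where
  "quadratic_metric V d \<theta> \<longleftrightarrow> finite V \<and> (\<forall>x\<in>V. \<forall>y\<in>V. d x y = d y x) \<and>
     (\<exists>r. \<forall>x\<in>V. (\<Sum>z\<in>V. real (d x z)) = r) \<and>
     (\<exists>c. \<forall>x\<in>V. \<forall>y\<in>V. (\<Sum>z\<in>V. real (d x z) * real (d z y)) = c - \<theta> * card V * d x y)"

lemma quadratic_metricI:
  fixes \<theta> :: real
  assumes "finite V" "\<And>x y. x \<in> V \<Longrightarrow> y \<in> V \<Longrightarrow> d x y = d y x"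
    and "\<And>x. x \<in> V \<Longrightarrow> (\<Sum>z\<in>V. real (d x z)) = r"
    and "\<And>x y. x \<in> V \<Longrightarrow> y \<in> V \<Longrightarrow>
      (\<Sum>z\<in>V. real (d x z) * real (d z y)) = c - \<theta> * card V * d x y"
  shows "quadratic_metric V d \<theta>"
  unfolding quadratic_metric_def using assms by auto

lemma quadratic_metricE:
  assumes "quadratic_metric V d \<theta>"
  obtains r c where "finite V" "\<And>x y. x \<in> V \<Longrightarrow> y \<in> V \<Longrightarrow> d x y = d y x"
    and "\<And>x. x \<in> V \<Longrightarrow> (\<Sum>z\<in>V. real (d x z)) = r"
    and "\<And>x y. x \<in> V \<Longrightarrow> y \<in> V \<Longrightarrow>
      (\<Sum>z\<in>V. real (d x z) * real (d z y)) = c - \<theta> * card V * d x y"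
  using assms unfolding quadratic_metric_def by blast

lemma quadratic_metric_bij:
  assumes d: "quadratic_metric W d \<theta>" and bij: "bij_betw \<phi> V W"
    and e: "\<And>x y. x \<in> V \<Longrightarrow> y \<in> V \<Longrightarrow> e x y = d (\<phi> x) (\<phi> y)"
  shows "quadratic_metric V e \<theta>"
proof -
  obtain r c where W: "finite W" "\<And>x y. x \<in> W \<Longrightarrow> y \<in> W \<Longrightarrow> d x y = d y x"
    "\<And>x. x \<in> W \<Longrightarrow> (\<Sum>z\<in>W. real (d x z)) = r"
    "\<And>x y. x \<in> W \<Longrightarrow> y \<in> W \<Longrightarrow> (\<Sum>z\<in>W. real (d x z) * real (d z y)) = c - \<theta> * card W * d x y"
    using d by (elim quadratic_metricE) blast
  have in_W: "\<phi> x \<in> W" if "x \<in> V" for x using bij that by (auto simp: bij_betw_def)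
  have sum_eq: "(\<Sum>z\<in>V. g (\<phi> z)) = (\<Sum>z\<in>W. g z)" for g :: "'a \<Rightarrow> real"
    by (rule sum.reindex_bij_betw[OF bij])
  show ?thesis
  proof (rule quadratic_metricI)
    show "finite V" using W(1) bij bij_betw_finite by blast
    show "e x y = e y x" if "x \<in> V" "y \<in> V" for x y using W(2) e in_W that by simp
    show "(\<Sum>z\<in>V. real (e x z)) = r" if "x \<in> V" for x
      using W(3)[OF in_W[OF that]] sum_eq[of "\<lambda>z. real (d (\<phi> x) z)"] e that by simp
    show "(\<Sum>z\<in>V. real (e x z) * real (e z y)) = c - \<theta> * card V * e x y" if "x \<in> V" "y \<in> V" for x y
      using W(4)[OF in_W in_W, OF that] sum_eq[of "\<lambda>z. real (d (\<phi> x) z) * real (d z (\<phi> y))"]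
        e that bij_betw_same_card[OF bij] by simp
  qed
qed

text \<open>The distance matrix of the product is \<open>D \<otimes> J + J \<otimes> E\<close>.
  Constant row sums turn the two mixed terms of its square into multiples of the all-ones matrix,
  and squaring \<open>J\<close> supplies the cardinality of the other factor, so both pure terms
  acquire the common coefficient \<open>\<theta> * card (V \<times> W)\<close>.\<close>

lemma quadratic_metric_prod:
  assumes "quadratic_metric V d \<theta>" "quadratic_metric W e \<theta>"
  shows "quadratic_metric (V \<times> W) (\<lambda>(x, u) (y, v). d x y + e u v) \<theta>"
proof -
  obtain r c where V: "finite V" "\<And>x y. x \<in> V \<Longrightarrow> y \<in> V \<Longrightarrow> d x y = d y x"
    "\<And>x. x \<in> V \<Longrightarrow> (\<Sum>z\<in>V. real (d x z)) = r"
    "\<And>x y. x \<in> V \<Longrightarrow> y \<in> V \<Longrightarrow> (\<Sum>z\<in>V. real (d x z) * real (d z y)) = c - \<theta> * card V * d x y"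
    using assms(1) by (elim quadratic_metricE) blast
  obtain r' c' where W: "finite W" "\<And>x y. x \<in> W \<Longrightarrow> y \<in> W \<Longrightarrow> e x y = e y x"
    "\<And>x. x \<in> W \<Longrightarrow> (\<Sum>z\<in>W. real (e x z)) = r'"
    "\<And>x y. x \<in> W \<Longrightarrow> y \<in> W \<Longrightarrow> (\<Sum>z\<in>W. real (e x z) * real (e z y)) = c' - \<theta> * card W * e x y"
    using assms(2) by (elim quadratic_metricE) blast
  have V': "(\<Sum>z\<in>V. real (d z x)) = r" if "x \<in> V" for x
    using V(2,3) that by (metis (no_types, lifting) sum.cong)
  have W': "(\<Sum>z\<in>W. real (e z x)) = r'" if "x \<in> W" for x
    using W(2,3) that by (metis (no_types, lifting) sum.cong)
  show ?thesis
  proof (rule quadratic_metricI)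
    show "finite (V \<times> W)" using V W by simp
    show "(case p of (x, u) \<Rightarrow> \<lambda>(y, v). d x y + e u v) q = (case q of (x, u) \<Rightarrow> \<lambda>(y, v). d x y + e u v) p"
      if "p \<in> V \<times> W" "q \<in> V \<times> W" for p q
      using V(2) W(2) that by auto
    show "(\<Sum>s\<in>V \<times> W. real ((case p of (x, u) \<Rightarrow> \<lambda>(y, v). d x y + e u v) s))
        = card W * r + card V * r'"
      if pV: "p \<in> V \<times> W" for p
    proof -
      obtain x u where p: "p = (x, u)" "x \<in> V" "u \<in> W" using pV by auto
      have "(\<Sum>s\<in>V \<times> W. real ((case p of (x, u) \<Rightarrow> \<lambda>(y, v). d x y + e u v) s))
        = (\<Sum>z\<in>V. \<Sum>w\<in>W. real (d x z) + real (e u w))"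
        unfolding sum.cartesian_product by (rule sum.cong) (auto simp: p)
      then show ?thesis
        using V(3)[OF p(2)] W(3)[OF p(3)] by (simp add: sum.distrib flip: sum_distrib_left)
    qed
    show "(\<Sum>s\<in>V \<times> W. real ((case p of (x, u) \<Rightarrow> \<lambda>(y, v). d x y + e u v) s)
          * real ((case s of (x, u) \<Rightarrow> \<lambda>(y, v). d x y + e u v) q))
        = card W * c + card V * c' + 2 * r * r'
          - \<theta> * card (V \<times> W) * real ((case p of (x, u) \<Rightarrow> \<lambda>(y, v). d x y + e u v) q)"
      if pq: "p \<in> V \<times> W" "q \<in> V \<times> W" for p q
    proof -
      obtain x u where p: "p = (x, u)" "x \<in> V" "u \<in> W" using pq by auto
      obtain y v where q: "q = (y, v)" "y \<in> V" "v \<in> W" using pq by auto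
      have "(\<Sum>s\<in>V \<times> W. real ((case p of (x, u) \<Rightarrow> \<lambda>(y, v). d x y + e u v) s)
          * real ((case s of (x, u) \<Rightarrow> \<lambda>(y, v). d x y + e u v) q))
        = (\<Sum>z\<in>V. \<Sum>w\<in>W. (real (d x z) + real (e u w)) * (real (d z y) + real (e w v)))"
        unfolding sum.cartesian_product by (rule sum.cong) (auto simp: p q)
      also have "\<dots> = (\<Sum>z\<in>V. \<Sum>w\<in>W. real (d x z) * real (d z y))
          + (\<Sum>z\<in>V. \<Sum>w\<in>W. real (d x z) * real (e w v))
          + (\<Sum>z\<in>V. \<Sum>w\<in>W. real (d z y) * real (e u w))
          + (\<Sum>z\<in>V. \<Sum>w\<in>W. real (e u w) * real (e w v))"
        by (simp add: distrib_left distrib_right sum.distrib mult.commute)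
      also have "\<dots> = card W * (c - \<theta> * card V * d x y) + r * r' + r * r'
          + card V * (c' - \<theta> * card W * e u v)"
        using V(3)[OF p(2)] V'[OF q(2)] V(4)[OF p(2) q(2)] W(3)[OF p(3)] W'[OF q(3)] W(4)[OF p(3) q(3)]
        by (simp flip: sum_distrib_left sum_distrib_right)
      finally show ?thesis using p q by (simp add: card_cartesian_product algebra_simps)
    qed
  qed
qed

text \<open>Replaces vectors indexed by list positions by functions on vertices, so that the
  spectral argument can work with sums over the vertex set. Distinctness makes the position of a
  vertex unique.\<close>

lemma distance_matrix_eigenvalue_iff:
  assumes "distinct vs"
  shows "eigenvalue (distance_matrix G vs) k \<longleftrightarrow>
    (\<exists>g. (\<exists>x\<in>set vs. g x \<noteq> 0) \<and>
      (\<forall>x\<in>set vs. (\<Sum>z\<in>set vs. of_nat (graph_dist G x z) * g z) = k * g x))"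
    (is "_ \<longleftrightarrow> (\<exists>g. ?P g)")
proof
  let ?n = "length vs" and ?D = "distance_matrix G vs"
  have dim: "dim_row ?D = ?n" "dim_col ?D = ?n" by (auto simp: distance_matrix_def)
  have bij: "bij_betw ((!) vs) {..<?n} (set vs)"
    by (rule bij_betw_nth) (use assms in auto)
  have sum_vs: "(\<Sum>z\<in>set vs. h z) = (\<Sum>i<?n. h (vs ! i))" for h :: "'a \<Rightarrow> complex"
    using sum.reindex_bij_betw[OF bij, of h] by simp
  have mult: "(?D *\<^sub>v v) $ i = (\<Sum>j<?n. of_nat (graph_dist G (vs ! i) (vs ! j)) * v $ j)"
    if "i < ?n" "dim_vec v = ?n" for i v
    using that by (simp add: distance_matrix_def scalar_prod_def lessThan_atLeast0)
  show "\<exists>g. ?P g" if k: "eigenvalue ?D k"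
  proof -
    obtain v where v: "dim_vec v = ?n" "v \<noteq> 0\<^sub>v ?n" "?D *\<^sub>v v = k \<cdot>\<^sub>v v"
      using k unfolding eigenvalue_def eigenvector_def dim by (auto dest: carrier_vecD)
    define g where "g x = v $ the_inv_into {..<?n} ((!) vs) x" for x
    have g: "g (vs ! i) = v $ i" if "i < ?n" for i
      using bij that by (simp add: g_def bij_betw_def the_inv_into_f_f)
    have "\<exists>i<?n. v $ i \<noteq> 0" using v(1,2) by (metis eq_vecI index_zero_vec)
    moreover have "(\<Sum>j<?n. of_nat (graph_dist G (vs ! i) (vs ! j)) * g (vs ! j)) = k * g (vs ! i)"
      if "i < ?n" for i
      using mult[OF that v(1)] v(1,3) g that by simp
    ultimately show ?thesis
      unfolding sum_vs using g by (intro exI[of _ g]) (auto simp: in_set_conv_nth Bex_def)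
  qed
  show "eigenvalue ?D k" if ex: "\<exists>g. ?P g"
  proof -
    obtain g x where x: "x \<in> set vs" "g x \<noteq> 0"
      and g: "\<And>x. x \<in> set vs \<Longrightarrow> (\<Sum>z\<in>set vs. of_nat (graph_dist G x z) * g z) = k * g x"
      using ex by blast
    let ?v = "vec ?n (\<lambda>i. g (vs ! i))"
    obtain i where "i < ?n" "g (vs ! i) \<noteq> 0" using x by (metis in_set_conv_nth)
    then have "?v $ i \<noteq> 0\<^sub>v ?n $ i" by simp
    then have "?v \<noteq> 0\<^sub>v ?n" by metis
    moreover have "?D *\<^sub>v ?v = k \<cdot>\<^sub>v ?v"
    proof (rule eq_vecI)
      fix i assume "i < dim_vec (k \<cdot>\<^sub>v ?v)"
      then show "(?D *\<^sub>v ?v) $ i = (k \<cdot>\<^sub>v ?v) $ i"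
        using g mult[of i ?v] by (simp add: sum_vs)
    qed (simp add: dim)
    ultimately show ?thesis unfolding eigenvalue_def eigenvector_def dim by (intro exI[of _ ?v]) simp
  qed
qed

text \<open>
  On the orthogonal complement of the constants, \<open>D\<^sup>2 = - t D\<close>. An eigenvector for \<open>- t\<close> is the
  difference of two columns of \<open>D\<close>, and adding \<open>t\<close> times the difference of the corresponding unit
  vectors gives a vector in the kernel.
\<close>

lemma spectrum_distance_matrix:
  fixes G :: "'a pair_pre_digraph"
  assumes q: "quadratic_metric (set vs) (graph_dist G) \<theta>" and \<theta>: "\<theta> > 0" and "distinct vs"
    and abc: "a \<in> set vs" "b \<in> set vs" "c \<in> set vs" "a \<noteq> b" "a \<noteq> c"
    and d0: "\<And>x y. x \<in> set vs \<Longrightarrow> y \<in> set vs \<Longrightarrow> graph_dist G x y = 0 \<longleftrightarrow> x = y"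
    and ne: "graph_dist G a b \<noteq> graph_dist G a c"
  shows "card (spectrum (distance_matrix G vs)) = 3 \<and> 0 \<in> spectrum (distance_matrix G vs)"
proof -
  let ?V = "set vs"
  define d :: "'a \<Rightarrow> 'a \<Rightarrow> complex" where "d x y = of_nat (graph_dist G x y)" for x y
  obtain r' c' where V: "\<And>x y. x \<in> ?V \<Longrightarrow> y \<in> ?V \<Longrightarrow> graph_dist G x y = graph_dist G y x"
    "\<And>x. x \<in> ?V \<Longrightarrow> (\<Sum>z\<in>?V. real (graph_dist G x z)) = r'"
    "\<And>x y. x \<in> ?V \<Longrightarrow> y \<in> ?V \<Longrightarrow> (\<Sum>z\<in>?V. real (graph_dist G x z) * real (graph_dist G z y))
       = c' - \<theta> * card ?V * graph_dist G x y"
    using q by (elim quadratic_metricE) blast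
  define t where "t = \<theta> * card ?V"
  have "card ?V > 0" using abc(1) by (auto simp: card_gt_0_iff)
  then have t: "t > 0" using \<theta> by (simp add: t_def)
  \<comment> \<open>One positive entry makes the row sum positive; with \<open>t > 0\<close> this
    separates \<open>r\<close>, 0 and \<open>- T\<close>.\<close>
  have "r' \<ge> real (graph_dist G a b)"
    unfolding V(2)[OF abc(1), symmetric] using abc by (intro member_le_sum) auto
  then have r': "r' > 0" using d0[OF abc(1,2)] abc by (simp add: order_less_le_trans)
  define r where "r = complex_of_real r'"
  define T where "T = complex_of_real t"
  define C where "C = complex_of_real c'"
  have nz: "r \<noteq> 0" "T \<noteq> 0" "r \<noteq> - T"
    using t r' by (auto simp: r_def T_def complex_eq_iff)
  have sym: "d x y = d y x" if "x \<in> ?V" "y \<in> ?V" for x y using V(1) that by (simp add: d_def)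
  have row: "(\<Sum>z\<in>?V. d x z) = r" if "x \<in> ?V" for x
    using arg_cong[OF V(2)[OF that], of complex_of_real] by (simp add: d_def r_def)
  have col: "(\<Sum>z\<in>?V. d z x) = r" if "x \<in> ?V" for x
    using row[OF that] sym that by (metis (no_types, lifting) sum.cong)
  have sq: "(\<Sum>z\<in>?V. d x z * d z y) = C - T * d x y" if "x \<in> ?V" "y \<in> ?V" for x y
    using arg_cong[OF V(3)[OF that], of complex_of_real] by (simp add: d_def C_def T_def t_def)
  have ev: "eigenvalue (distance_matrix G vs) k \<longleftrightarrow>
      (\<exists>g. (\<exists>x\<in>?V. g x \<noteq> 0) \<and> (\<forall>x\<in>?V. (\<Sum>z\<in>?V. d x z * g z) = k * g x))" for k
    unfolding d_def by (rule distance_matrix_eigenvalue_iff[OF \<open>distinct vs\<close>])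
  have "k \<in> {r, 0, - T}"
    if k: "eigenvalue (distance_matrix G vs) k" for k
  proof -
    obtain g y where y: "y \<in> ?V" "g y \<noteq> 0"
      and g: "\<And>x. x \<in> ?V \<Longrightarrow> (\<Sum>z\<in>?V. d x z * g z) = k * g x"
      using k unfolding ev by blast
    \<comment> \<open>Summing the eigenvalue equation over all vertices and using the column sums
      shows that \<open>k = r\<close> or \<open>g\<close> is orthogonal to the constants. In the
      second case \<open>C\<close> drops out of the squared equation.\<close>
    have "k * (\<Sum>x\<in>?V. g x) = (\<Sum>x\<in>?V. \<Sum>z\<in>?V. d x z * g z)"
      using g by (simp add: sum_distrib_left)
    also have "\<dots> = (\<Sum>z\<in>?V. (\<Sum>x\<in>?V. d x z) * g z)"
      by (subst sum.swap) (simp add: sum_distrib_right)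
    also have "\<dots> = r * (\<Sum>x\<in>?V. g x)" using col by (simp add: sum_distrib_left)
    finally have orth: "k = r \<or> (\<Sum>x\<in>?V. g x) = 0" by auto
    have "k * (k * g y) = k * (\<Sum>w\<in>?V. d y w * g w)" using g y(1) by simp
    also have "\<dots> = (\<Sum>w\<in>?V. d y w * (k * g w))"
      by (simp add: sum_distrib_left mult.left_commute)
    also have "\<dots> = (\<Sum>w\<in>?V. d y w * (\<Sum>z\<in>?V. d w z * g z))" using g by simp
    also have "\<dots> = (\<Sum>z\<in>?V. (\<Sum>w\<in>?V. d y w * d w z) * g z)"
      by (simp add: sum_distrib_left sum_distrib_right mult.assoc) (rule sum.swap)
    also have "\<dots> = (\<Sum>z\<in>?V. (C - T * d y z) * g z)" using sq y(1) by simp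
    also have "\<dots> = C * (\<Sum>z\<in>?V. g z) - T * (\<Sum>z\<in>?V. d y z * g z)"
      by (simp add: left_diff_distrib sum_subtractf sum_distrib_left mult.assoc)
    also have "\<dots> = C * (\<Sum>z\<in>?V. g z) - T * (k * g y)" using g[OF y(1)] by simp
    finally have "(\<Sum>x\<in>?V. g x) = 0 \<Longrightarrow> k * (k + T) * g y = 0"
      by (simp add: algebra_simps)
    with orth y show ?thesis by (auto simp: add_eq_0_iff2)
  qed
  moreover have "eigenvalue (distance_matrix G vs) r"
    unfolding ev using row abc(1) by (intro exI[of _ "\<lambda>_. 1"]) auto
  moreover have col_diff: "(\<Sum>z\<in>?V. d x z * (d z b - d z c)) = - T * (d x b - d x c)" if "x \<in> ?V" for x
    using sq[OF that] abc by (simp add: right_diff_distrib sum_subtractf)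
  moreover have "eigenvalue (distance_matrix G vs) (- T)"
    unfolding ev using col_diff abc ne by (intro exI[of _ "\<lambda>z. d z b - d z c"]) (auto simp: d_def)
  moreover have "eigenvalue (distance_matrix G vs) 0"
    unfolding ev
  proof (intro exI conjI)
    let ?g = "\<lambda>z. (d z b - d z c) + T * (of_bool (z = b) - of_bool (z = c))"
    \<comment> \<open>Both unit vectors vanish at \<open>a\<close>, which differs from
      \<open>b\<close> and \<open>c\<close>, so the value there is the nonzero difference of the two
      distances.\<close>
    show "\<exists>x\<in>?V. ?g x \<noteq> 0" using abc ne by (intro bexI[of _ a]) (auto simp: d_def)
    show "\<forall>x\<in>?V. (\<Sum>z\<in>?V. d x z * ?g z) = 0 * ?g x"
    proof
      fix x assume x: "x \<in> ?V"
      have unit: "(\<Sum>z\<in>?V. d x z * of_bool (z = e)) = d x e" if "e \<in> ?V" for e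
        using that by (simp add: of_bool_def if_distrib[of "\<lambda>u. d x _ * u"] cong: if_cong)
      have "(\<Sum>z\<in>?V. d x z * ?g z) = (\<Sum>z\<in>?V. d x z * (d z b - d z c)
          + T * (d x z * of_bool (z = b) - d x z * of_bool (z = c)))"
        by (intro sum.cong refl) (simp only: algebra_simps)
      also have "\<dots> = (\<Sum>z\<in>?V. d x z * (d z b - d z c))
          + T * ((\<Sum>z\<in>?V. d x z * of_bool (z = b)) - (\<Sum>z\<in>?V. d x z * of_bool (z = c)))"
        by (simp only: sum.distrib sum_subtractf sum_distrib_left[symmetric])
      finally show "(\<Sum>z\<in>?V. d x z * ?g z) = 0 * ?g x"
        using col_diff[OF x] unit abc by simp
    qed
  qed
  ultimately have "spectrum (distance_matrix G vs) = {r, 0, - T}"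
    unfolding spectrum_def by blast
  then show ?thesis using nz by simp
qed

lemma graph_on_simps [simp]:
  "pverts (graph_on V adj) = V"
  "(x, y) \<in> parcs (graph_on V adj) \<longleftrightarrow> x \<in> V \<and> y \<in> V \<and> adj x y"
  by (auto simp: graph_on_def)

lemma parcs_graph_on_subset: "parcs (graph_on V adj) \<subseteq> V \<times> V"
  by (auto simp: graph_on_def)

section \<open>Hamming and Doob graphs\<close>

lemma geodesic_cartesian_product:
  assumes "geodesic G f" "geodesic H g"
  shows "geodesic (cartesian_product G H) (\<lambda>(x, u) (y, v). f x y + g u v)"
proof -
  note G = geodesicD[OF assms(1)] and H = geodesicD[OF assms(2)]
  show ?thesis
    unfolding cartesian_product_def
  proof (rule geodesicI, goal_cases)
    case 1
    show ?case using parcs_graph_on_subset by simp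
  next
    case (2 p q)
    then show ?case using G(2) H(2) by auto
  next
    case (3 p q s)
    then obtain x u y v z w where p: "p = (x, u)" "x \<in> pverts G" "u \<in> pverts H"
      and q: "q = (y, v)" "y \<in> pverts G" "v \<in> pverts H"
      and s: "s = (z, w)" "(x, z) \<in> parcs G \<and> u = w \<or> x = z \<and> (u, w) \<in> parcs H"
      by auto
    then show ?case using G(3)[OF q(2), of x z] H(3)[OF q(3), of u w] by auto
  next
    case (4 p q k)
    then obtain x u y v where p: "p = (x, u)" "x \<in> pverts G" "u \<in> pverts H"
      and q: "q = (y, v)" "y \<in> pverts G" "v \<in> pverts H"
      by auto
    \<comment> \<open>Descend in the first coordinate as long as it differs from the target, and
      only then in the second.\<close>
    show ?case
    proof (cases "f x y")
      case 0
      then have "g u v = Suc k" using 4 p q by simp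
      then obtain w where "(u, w) \<in> parcs H" "g w v = k" using H(4) p q by blast
      then show ?thesis using 0 p q H(1) by (intro exI[of _ "(x, w)"]) auto
    next
      case (Suc l)
      then obtain z where "(x, z) \<in> parcs G" "f z y = l" using G(4) p q by blast
      then show ?thesis using 4 Suc p q G(1) by (intro exI[of _ "(z, u)"]) auto
    qed
  qed
qed

section \<open>Cartesian powers\<close>

definition list_metric :: "('a \<Rightarrow> 'a \<Rightarrow> nat) \<Rightarrow> 'a list \<Rightarrow> 'a list \<Rightarrow> nat" where
  "list_metric d xs ys = (\<Sum>i<length xs. d (xs ! i) (ys ! i))"

lemma geodesic_cartesian_power:
  assumes "geodesic G f"
  shows "geodesic (cartesian_power G n) (list_metric f)"
proof -
  note G = geodesicD[OF assms]
  let ?V = "{xs. length xs = n \<and> set xs \<subseteq> pverts G}"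
  have nth: "xs ! i \<in> pverts G" if "xs \<in> ?V" "i < n" for xs i
    using that by auto
  \<comment> \<open>An arc of the power changes a single coordinate. Isolating its summand reduces
    both the bound along an arc and the descent to the corresponding facts about
    \<open>G\<close>.\<close>
  have split_metric: "list_metric f xs ys = f (xs ! i) (ys ! i) + (\<Sum>j\<in>{..<n} - {i}. f (xs ! j) (ys ! j))"
    if "xs \<in> ?V" "i < n" for xs ys i
    using that by (simp add: list_metric_def sum.remove[of _ i])
  show ?thesis
    unfolding cartesian_power_def
  proof (rule geodesicI, goal_cases)
    case 1
    show ?case using parcs_graph_on_subset by simp
  next
    case (2 xs ys)
    then have "list_metric f xs ys = 0 \<longleftrightarrow> (\<forall>i<n. xs ! i = ys ! i)"
      using G(2) nth by (simp add: list_metric_def Ball_def)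
    then show ?case using 2 by (auto simp: list_eq_iff_nth_eq)
  next
    case (3 xs ys zs)
    then obtain i where V: "xs \<in> ?V" "ys \<in> ?V" "zs \<in> ?V"
      and i: "i < n" "(xs ! i, zs ! i) \<in> parcs G" "\<forall>j<n. j \<noteq> i \<longrightarrow> xs ! j = zs ! j"
      by auto
    then show ?case
      using split_metric[OF V(1) i(1), of ys] split_metric[OF V(3) i(1), of ys]
        G(3)[OF nth[OF V(2) i(1)] i(2)]
      by simp
  next
    case (4 xs ys k)
    then have V: "xs \<in> ?V" "ys \<in> ?V" by auto
    have "\<exists>i<n. f (xs ! i) (ys ! i) \<noteq> 0"
    proof (rule ccontr)
      assume "\<not> ?thesis"
      then show False using 4 by (simp add: list_metric_def)
    qed
    then obtain i l where i: "i < n" "f (xs ! i) (ys ! i) = Suc l"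
      by (metis not0_implies_Suc)
    then obtain z where z: "(xs ! i, z) \<in> parcs G" "f z (ys ! i) = l"
      using G(4)[OF nth[OF V(1) i(1)] nth[OF V(2) i(1)]] by blast
    let ?zs = "xs[i := z]"
    have zV: "?zs \<in> ?V" using V z G(1) set_update_subset_insert[of xs i z] by auto
    have "list_metric f ?zs ys = k"
      using split_metric[OF V(1) i(1), of ys] split_metric[OF zV i(1), of ys] 4(3) i z V(1) by simp
    then show ?case
      using V zV z i by (intro exI[of _ ?zs]) auto
  qed
qed

text \<open>Splitting off the head exhibits each power as a product whose factors share the same
  \<open>\<theta>\<close>. The induction can start from the empty word because all distances there
  vanish, so every \<open>\<theta>\<close> is admissible.\<close>

lemma quadratic_metric_power:
  assumes "quadratic_metric V d \<theta>"
  shows "quadratic_metric {xs. length xs = n \<and> set xs \<subseteq> V} (list_metric d) \<theta>"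
proof (induction n)
  case 0
  have "{xs. length xs = 0 \<and> set xs \<subseteq> V} = {[]}" by auto
  then show ?case
    by (simp add: quadratic_metric_def list_metric_def)
next
  case (Suc n)
  let ?\<phi> = "\<lambda>xs. (hd xs, tl xs)"
  have "bij_betw ?\<phi> {xs. length xs = Suc n \<and> set xs \<subseteq> V} (V \<times> {xs. length xs = n \<and> set xs \<subseteq> V})"
    by (rule bij_betw_byWitness[where f' = "\<lambda>(x, xs). x # xs"]) (auto simp: length_Suc_conv)
  then show ?case
  proof (rule quadratic_metric_bij[OF quadratic_metric_prod[OF assms Suc]])
    fix xs ys assume "xs \<in> {xs. length xs = Suc n \<and> set xs \<subseteq> V}" "ys \<in> {xs. length xs = Suc n \<and> set xs \<subseteq> V}"
    then obtain x xs' y ys' where "xs = x # xs'" "ys = y # ys'"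
      by (auto simp: length_Suc_conv)
    then show "list_metric d xs ys = (case ?\<phi> xs of (x, u) \<Rightarrow> \<lambda>(y, v). d x y + list_metric d u v) (?\<phi> ys)"
      by (simp add: list_metric_def sum.lessThan_Suc_shift del: sum.lessThan_Suc)
  qed
qed

section \<open>Complete graphs as factors\<close>

lemma geodesic_complete_graph: "geodesic (complete_graph q) (\<lambda>x y. if x = y then 0 else 1)"
  by (rule geodesicI) (auto simp: complete_graph_def graph_on_def split: if_splits)

text \<open>Here \<open>D = J - I\<close>, so the square is
  \<open>(q - 2) J + I = (q - 1) J - D\<close>. Thus \<open>t = 1\<close>, and dividing by the
  number of vertices gives \<open>1 / q\<close>.\<close>

lemma quadratic_metric_complete_graph:
  assumes "q > 0"
  shows "quadratic_metric {0..<q} (\<lambda>x y. if x = y then 0 else 1) (1 / real q)"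
proof (rule quadratic_metricI[where r = "real q - 1" and c = "real q - 1"])
  have one: "(\<Sum>z\<in>{0..<q}. of_bool (z = x)) = (1 :: real)" if "x \<in> {0..<q}" for x
    using that by (simp add: of_bool_def)
  show "(\<Sum>z\<in>{0..<q}. real (if x = z then 0 else 1)) = real q - 1" if "x \<in> {0..<q}" for x
  proof -
    have "(\<Sum>z\<in>{0..<q}. real (if x = z then 0 else 1)) = (\<Sum>z\<in>{0..<q}. 1 - of_bool (z = x))"
      by (intro sum.cong) auto
    then show ?thesis using one[OF that] by (simp only: sum_subtractf) simp
  qed
  show "(\<Sum>z\<in>{0..<q}. real (if x = z then 0 else 1) * real (if z = y then 0 else 1))
      = real q - 1 - 1 / real q * card {0..<q} * real (if x = y then 0 else 1)"
    if "x \<in> {0..<q}" "y \<in> {0..<q}" for x y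
  proof -
    have "(\<Sum>z\<in>{0..<q}. real (if x = z then 0 else 1) * real (if z = y then 0 else 1))
        = (\<Sum>z\<in>{0..<q}. 1 - of_bool (z = x) - of_bool (z = y) + of_bool (x = y) * of_bool (z = x))"
      by (intro sum.cong) auto
    also have "\<dots> = real q - 2 + of_bool (x = y)"
      using one[OF that(1)] one[OF that(2)]
      by (simp only: sum_subtractf sum.distrib sum_distrib_left[symmetric]) simp
    finally show ?thesis using assms by simp
  qed
qed auto

text \<open>The set of positions where two words differ is a singleton exactly when they are
  adjacent in the power. As the vertex sets also coincide, the graphs are equal and not merely
  isomorphic, so the facts on powers transfer by rewriting.\<close>

lemma hamming_graph_eq_power: "hamming_graph d q = cartesian_power (complete_graph q) d"
proof -
  have "hamming_dist x y = 1 \<longleftrightarrow>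
      (\<exists>i<d. (x ! i, y ! i) \<in> parcs (complete_graph q) \<and> (\<forall>j<d. j \<noteq> i \<longrightarrow> x ! j = y ! j))"
    if "x \<in> words d q" "y \<in> words d q" for x y
  proof -
    have "x ! i < q" "y ! i < q" if "i < d" for i
      using \<open>x \<in> words d q\<close> \<open>y \<in> words d q\<close> that
      by (auto simp: words_def subset_iff)
    then have arc: "(x ! i, y ! i) \<in> parcs (complete_graph q) \<longleftrightarrow> x ! i \<noteq> y ! i" if "i < d" for i
      using that by (simp add: complete_graph_def)
    have len: "length x = d" using that by (simp add: words_def)
    have "hamming_dist x y = 1 \<longleftrightarrow> (\<exists>i. {j. j < d \<and> x ! j \<noteq> y ! j} = {i})"
      by (simp add: hamming_dist_def len card_1_singleton_iff)
    also have "\<dots> \<longleftrightarrow> (\<exists>i<d. x ! i \<noteq> y ! i \<and> (\<forall>j<d. j \<noteq> i \<longrightarrow> x ! j = y ! j))"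
      by (rule ex_cong1) blast
    finally show ?thesis using arc by blast
  qed
  then have "{(x, y). x \<in> words d q \<and> y \<in> words d q \<and> hamming_dist x y = 1} =
     {(x, y). x \<in> words d q \<and> y \<in> words d q \<and>
        (\<exists>i<d. (x ! i, y ! i) \<in> parcs (complete_graph q) \<and> (\<forall>j<d. j \<noteq> i \<longrightarrow> x ! j = y ! j))}"
    by blast
  moreover have "words d q = {xs. length xs = d \<and> set xs \<subseteq> pverts (complete_graph q)}"
    by (simp add: words_def complete_graph_def)
  ultimately show ?thesis
    by (simp add: hamming_graph_def cartesian_power_def graph_on_def)
qed

section \<open>The Shrikhande graph as a factor\<close>

definition shrikhande_dist :: "int \<times> int \<Rightarrow> int \<times> int \<Rightarrow> nat" where
  "shrikhande_dist x y = (if x = y then 0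
     else if ((fst x - fst y) mod 4, (snd x - snd y) mod 4)
       \<in> {(1, 0), (3, 0), (0, 1), (0, 3), (1, 1), (3, 3)} then 1 else 2)"

text \<open>Justifies the value 2 for all distinct non-adjacent pairs: the graph has diameter 2.
  With the distance given by a closed formula this is a finite evaluation.\<close>

lemma shrikhande_common_neighbour:
  "\<forall>x\<in>{0..<4} \<times> {0..<4}. \<forall>y\<in>{0..<4} \<times> {0..<4}. shrikhande_dist x y = 2 \<longrightarrow>
     (\<exists>z\<in>{0..<4} \<times> {0..<4}. shrikhande_dist x z = 1 \<and> shrikhande_dist z y = 1)"
  by code_simp

lemma shrikhande_sym:
  "\<forall>x\<in>{0..<4} \<times> {0..<4}. \<forall>y\<in>{0..<4} \<times> {0..<4}. shrikhande_dist x y = shrikhande_dist y x"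
  by code_simp

lemma shrikhande_row_sum:
  "\<forall>x\<in>{0..<4} \<times> {0..<4}. (\<Sum>z\<in>{0..<4} \<times> {0..<4}. shrikhande_dist x z) = 24"
  by code_simp

text \<open>The graph is strongly regular with parameters (16, 6, 2, 2), so
  \<open>D = 2 (J - I) - A\<close> with \<open>A\<close> the adjacency matrix and
  \<open>A\<^sup>2 = 4 I + 2 J\<close>; expanding gives \<open>D\<^sup>2 = 42 J - 4 D\<close>. The
  term in \<open>D\<close> stands on the left because the entries are natural numbers.\<close>

lemma shrikhande_square:
  "\<forall>x\<in>{0..<4} \<times> {0..<4}. \<forall>y\<in>{0..<4} \<times> {0..<4}.
     (\<Sum>z\<in>{0..<4} \<times> {0..<4}. shrikhande_dist x z * shrikhande_dist z y)
       + 4 * shrikhande_dist x y = 42"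
  by code_simp

lemma shrikhande_arc_iff:
  "(x, y) \<in> parcs shrikhande_graph \<longleftrightarrow>
     x \<in> {0..<4} \<times> {0..<4} \<and> y \<in> {0..<4} \<times> {0..<4} \<and> shrikhande_dist x y = 1"
  by (cases x; cases y) (auto simp: shrikhande_graph_def shrikhande_dist_def)

lemma geodesic_shrikhande_graph: "geodesic shrikhande_graph shrikhande_dist"
proof -
  let ?V = "{0..<4} \<times> {0..<4} :: (int \<times> int) set"
  have V: "pverts shrikhande_graph = ?V" by (simp add: shrikhande_graph_def)
  have le2: "shrikhande_dist x y \<le> 2" and zero: "shrikhande_dist x y = 0 \<longleftrightarrow> x = y" for x y
    by (simp_all add: shrikhande_dist_def)
  show ?thesis
  proof (rule geodesicI, unfold V shrikhande_arc_iff)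
    show "parcs shrikhande_graph \<subseteq> ?V \<times> ?V" using shrikhande_arc_iff by auto
    show "shrikhande_dist x y = 0 \<longleftrightarrow> x = y" for x y by (rule zero)
    \<comment> \<open>Distances are at most 2, so only the value 0 on the right is critical; then
      \<open>z = y\<close>, and \<open>x\<close> is adjacent to \<open>y\<close>.\<close>
    show "shrikhande_dist x y \<le> shrikhande_dist z y + 1"
      if "x \<in> ?V \<and> z \<in> ?V \<and> shrikhande_dist x z = 1" for x y z
      using that le2[of x y] zero[of z y] by (cases "shrikhande_dist z y") auto
    show "\<exists>z. (x \<in> ?V \<and> z \<in> ?V \<and> shrikhande_dist x z = 1) \<and> shrikhande_dist z y = k"
      if "x \<in> ?V" "y \<in> ?V" "shrikhande_dist x y = Suc k" for x y k
    proof (cases "k = 0")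
      case True
      then show ?thesis using that zero[of y y] by (intro exI[of _ y]) auto
    next
      case False
      then have "shrikhande_dist x y = 2" "k = 1" using that le2[of x y] by auto
      then show ?thesis using that shrikhande_common_neighbour by blast
    qed
  qed
qed

lemma quadratic_metric_shrikhande: "quadratic_metric ({0..<4} \<times> {0..<4}) shrikhande_dist (1 / 4)"
proof (rule quadratic_metricI[where r = 24 and c = 42])
  let ?V = "{0..<4} \<times> {0..<4} :: (int \<times> int) set"
  show "shrikhande_dist x y = shrikhande_dist y x" if "x \<in> ?V" "y \<in> ?V" for x y
    using shrikhande_sym that by blast
  show "(\<Sum>z\<in>?V. real (shrikhande_dist x z)) = 24" if "x \<in> ?V" for x
    using bspec[OF shrikhande_row_sum that] by (simp flip: of_nat_sum)
  show "(\<Sum>z\<in>?V. real (shrikhande_dist x z) * real (shrikhande_dist z y))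
      = 42 - 1 / 4 * card ?V * shrikhande_dist x y" if "x \<in> ?V" "y \<in> ?V" for x y
    using arg_cong[OF bspec[OF bspec[OF shrikhande_square that(1)] that(2)], of real]
    by (simp add: card_cartesian_product)
qed simp

section \<open>Johnson graphs\<close>

text \<open>Removing \<open>T\<close> leaves an arbitrary subset of \<open>S - T\<close>. The bound
  on \<open>card T\<close> keeps \<open>k - card T\<close> from being truncated, in which case the
  right side would be 1 instead of 0.\<close>

lemma card_subsets_containing:
  assumes "finite S" "T \<subseteq> S" "card T \<le> k"
  shows "card {C. C \<subseteq> S \<and> card C = k \<and> T \<subseteq> C} = (card S - card T) choose (k - card T)"
proof -
  have fin: "finite T" using assms finite_subset by blast
  have "bij_betw (\<lambda>C. C - T) {C. C \<subseteq> S \<and> card C = k \<and> T \<subseteq> C} {C. C \<subseteq> S - T \<and> card C = k - card T}"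
  proof (rule bij_betw_byWitness[where f' = "\<lambda>C. C \<union> T"])
    show "(\<lambda>C. C - T) ` {C. C \<subseteq> S \<and> card C = k \<and> T \<subseteq> C} \<subseteq> {C. C \<subseteq> S - T \<and> card C = k - card T}"
      using fin by (auto simp: card_Diff_subset)
    show "(\<lambda>C. C \<union> T) ` {C. C \<subseteq> S - T \<and> card C = k - card T} \<subseteq> {C. C \<subseteq> S \<and> card C = k \<and> T \<subseteq> C}"
    proof clarify
      fix C assume C: "C \<subseteq> S - T" "card C = k - card T"
      then have "finite C" "C \<inter> T = {}" using assms(1) finite_subset by blast+
      then show "C \<union> T \<subseteq> S \<and> card (C \<union> T) = k \<and> T \<subseteq> C \<union> T"
        using C assms fin by (auto simp: card_Un_disjoint)
    qed
  qed auto
  then have "card {C. C \<subseteq> S \<and> card C = k \<and> T \<subseteq> C} = card {C. C \<subseteq> S - T \<and> card C = k - card T}"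
    by (rule bij_betw_same_card)
  also have "\<dots> = card (S - T) choose (k - card T)"
    using assms(1) by (intro n_subsets) simp
  finally show ?thesis using fin assms(2) by (simp add: card_Diff_subset)
qed

lemma card_Int_indicator:
  "finite A \<Longrightarrow> real (card (A \<inter> C)) = (\<Sum>a\<in>A. of_bool (a \<in> C))"
  by (simp add: sum.inter_filter[symmetric] Int_def flip: sum.inter_restrict)

section \<open>Intersections of k-subsets, used again for the Gosset graph with n = 8 and k =
  2\<close>

context
  fixes n k :: nat and V :: "nat set set"
  assumes V: "V = {A. A \<subseteq> {0..<n} \<and> card A = k}"
begin

lemma finite_subset_family: "finite V"
  by (rule finite_subset[of _ "Pow {0..<n}"]) (auto simp: V)

lemma subset_family_finite: "A \<in> V \<Longrightarrow> finite A"
  using finite_subset by (auto simp: V)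

lemma johnson_exchange:
  assumes "A \<in> V" "a \<in> A" "b \<in> {0..<n}" "b \<notin> A"
  shows "insert b (A - {a}) \<in> V" "A \<inter> insert b (A - {a}) = A - {a}" "card (A - {a}) + 1 = k"
  using assms subset_family_finite[OF assms(1)] card_gt_0_iff[of A]
  by (auto simp: V card_Diff_singleton)

text \<open>A neighbour \<open>Z\<close> has exactly one element outside \<open>A\<close>, so the
  exchange gains at most one element of \<open>B\<close>.\<close>

lemma card_Int_adjacent_le:
  assumes "A \<in> V" "Z \<in> V" "card (A \<inter> Z) + 1 = k"
  shows "card (Z \<inter> B) \<le> card (A \<inter> B) + 1"
proof -
  have fin: "finite A" "finite Z" using assms subset_family_finite by auto
  have "card (Z - A) = card Z - card (Z \<inter> A)"
    using fin by (intro card_Diff_subset_Int) simp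
  then have "card (Z - A) = 1" using assms by (simp add: V Int_commute)
  moreover have "card (Z \<inter> B) \<le> card ((A \<inter> B) \<union> (Z - A))"
    using fin by (intro card_mono) auto
  ultimately show ?thesis
    using card_Un_le[of "A \<inter> B" "Z - A"] by simp
qed

lemma card_Int_eq_iff:
  assumes "A \<in> V" "B \<in> V"
  shows "card (A \<inter> B) = k \<longleftrightarrow> A = B"
proof
  assume "card (A \<inter> B) = k"
  moreover have "finite A" "finite B" "card A = k" "card B = k"
    using subset_family_finite[OF assms(1)] subset_family_finite[OF assms(2)] assms
    by (simp_all add: V)
  moreover from calculation have "A \<inter> B = A"
    using card_subset_eq[of A "A \<inter> B"] by simp
  ultimately show "A = B"
    using card_subset_eq[of B A] by (simp add: inf.absorb_iff1)
qed (use assms in \<open>simp add: V\<close>)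

lemma card_Int_le: "A \<in> V \<Longrightarrow> card (A \<inter> B) \<le> k"
  using subset_family_finite[of A] by (auto simp: V intro!: card_mono)

text \<open>Distinct sets of equal size each have an element outside the other; exchanging two such
  elements moves \<open>A\<close> one step towards \<open>B\<close>.\<close>

lemma johnson_step:
  assumes "A \<in> V" "B \<in> V" "A \<noteq> B"
  obtains Z where "Z \<in> V" "card (A \<inter> Z) + 1 = k" "card (Z \<inter> B) = card (A \<inter> B) + 1"
proof -
  have fin: "finite A" "finite B" using assms subset_family_finite by auto
  obtain a where a: "a \<in> A" "a \<notin> B"
    using assms fin card_subset_eq[of B A] by (auto simp: V)
  obtain b where b: "b \<in> B" "b \<notin> A"
    using assms fin card_subset_eq[of A B] by (auto simp: V)
  have "b \<in> {0..<n}" using b assms by (auto simp: V)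
  note Z = johnson_exchange[OF assms(1) a(1) this b(2)]
  have "insert b (A - {a}) \<inter> B = insert b (A \<inter> B)" using a b by auto
  then have "card (insert b (A - {a}) \<inter> B) = card (A \<inter> B) + 1" using b fin by simp
  then show thesis using that Z by simp
qed

lemma sum_card_Int:
  assumes "A \<in> V" "2 \<le> k"
  shows "(\<Sum>C\<in>V. real (card (A \<inter> C))) = real k * real ((n - 1) choose (k - 1))"
proof -
  have "(\<Sum>C\<in>V. real (card (A \<inter> C))) = (\<Sum>C\<in>V. \<Sum>a\<in>A. of_bool (a \<in> C))"
    using card_Int_indicator[OF subset_family_finite[OF assms(1)]] by simp
  also have "\<dots> = (\<Sum>a\<in>A. \<Sum>C\<in>V. of_bool (a \<in> C))" by (rule sum.swap)
  also have "\<dots> = (\<Sum>a\<in>A. real ((n - 1) choose (k - 1)))"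
  proof (rule sum.cong[OF refl])
    fix a assume "a \<in> A"
    then have "{a} \<subseteq> {0..<n}" using assms by (auto simp: V)
    then have "card {C. C \<subseteq> {0..<n} \<and> card C = k \<and> {a} \<subseteq> C} = (n - 1) choose (k - 1)"
      using card_subsets_containing[of "{0..<n}" "{a}" k] assms(2) by simp
    moreover have "V \<inter> {C. a \<in> C} = {C. C \<subseteq> {0..<n} \<and> card C = k \<and> {a} \<subseteq> C}"
      by (auto simp: V)
    ultimately show "(\<Sum>C\<in>V. of_bool (a \<in> C)) = real ((n - 1) choose (k - 1))"
      using finite_subset_family by simp
  qed
  finally show ?thesis using assms(1) by (simp add: V)
qed

lemma sum_card_Int_mult:
  assumes "A \<in> V" "B \<in> V" "2 \<le> k"
  shows "(\<Sum>C\<in>V. real (card (A \<inter> C)) * real (card (C \<inter> B))) =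
    real k * real k * ((n - 2) choose (k - 2)) +
    (real ((n - 1) choose (k - 1)) - real ((n - 2) choose (k - 2))) * card (A \<inter> B)"
proof -
  let ?l1 = "real ((n - 1) choose (k - 1))" and ?l2 = "real ((n - 2) choose (k - 2))"
  have fin: "finite A" "finite B" using assms subset_family_finite by auto
  \<comment> \<open>The pair \<open>a\<close>, \<open>b\<close> amounts to one point or to two, with
    counts \<open>?l1\<close> and \<open>?l2\<close>. The correction for \<open>a = b\<close> is
    what later produces the term in \<open>card (A \<inter> B)\<close>.\<close>
  have pair: "(\<Sum>C\<in>V. of_bool (a \<in> C) * of_bool (b \<in> C)) = ?l2 + (?l1 - ?l2) * of_bool (a \<in> {b})"
    if "a \<in> A" "b \<in> B" for a b
  proof -
    have "{a, b} \<subseteq> {0..<n}" using assms that by (auto simp: V)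
    then have "card {C. C \<subseteq> {0..<n} \<and> card C = k \<and> {a, b} \<subseteq> C} = (n - card {a, b}) choose (k - card {a, b})"
      using card_subsets_containing[of "{0..<n}" "{a, b}" k] assms(3) by (simp add: card_insert_if)
    moreover have "V \<inter> {C. a \<in> C \<and> b \<in> C} = {C. C \<subseteq> {0..<n} \<and> card C = k \<and> {a, b} \<subseteq> C}"
      by (auto simp: V)
    moreover have "(\<Sum>C\<in>V. of_bool (a \<in> C) * of_bool (b \<in> C)) = (\<Sum>C\<in>V. of_bool (a \<in> C \<and> b \<in> C) :: real)"
      by (simp add: of_bool_conj)
    ultimately show ?thesis
      using finite_subset_family by (auto simp: numeral_2_eq_2)
  qed
  have "(\<Sum>C\<in>V. real (card (A \<inter> C)) * real (card (C \<inter> B)))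
      = (\<Sum>C\<in>V. \<Sum>a\<in>A. \<Sum>b\<in>B. of_bool (a \<in> C) * of_bool (b \<in> C))"
    using card_Int_indicator[OF fin(1)] card_Int_indicator[OF fin(2)]
    by (simp add: sum_product Int_commute[of _ B])
  also have "\<dots> = (\<Sum>a\<in>A. \<Sum>C\<in>V. \<Sum>b\<in>B. of_bool (a \<in> C) * of_bool (b \<in> C))"
    by (rule sum.swap)
  also have "\<dots> = (\<Sum>a\<in>A. \<Sum>b\<in>B. \<Sum>C\<in>V. of_bool (a \<in> C) * of_bool (b \<in> C))"
    by (intro sum.cong refl sum.swap)
  also have "\<dots> = (\<Sum>a\<in>A. \<Sum>b\<in>B. ?l2 + (?l1 - ?l2) * of_bool (a \<in> {b}))"
    using pair by simp
  also have "\<dots> = real (card A) * real (card B) * ?l2 + (?l1 - ?l2) * (\<Sum>a\<in>A. \<Sum>b\<in>B. of_bool (a \<in> {b}))"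
    by (simp only: sum.distrib sum_distrib_left[symmetric] sum_constant) (simp add: mult.left_commute)
  also have "(\<Sum>a\<in>A. \<Sum>b\<in>B. of_bool (a \<in> {b}) :: real) = (\<Sum>a\<in>A. of_bool (a \<in> B))"
    using fin by (intro sum.cong refl) (simp add: of_bool_def)
  finally show ?thesis
    using assms card_Int_indicator[OF fin(1), of B] by (simp add: V algebra_simps)
qed

end

text \<open>An exchange enlarges the intersection with \<open>B\<close> by at most one, and by
  exactly one for a suitable choice while \<open>A\<close> differs from \<open>B\<close>. The
  intersection has at most \<open>k\<close> elements, so the subtraction is never truncated.\<close>

lemma geodesic_johnson_graph:
  "geodesic (johnson_graph n k) (\<lambda>A B. k - card (A \<inter> B))"
proof -
  define V where "V = {A. A \<subseteq> {0..<n} \<and> card A = k}"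
  note J = V_def
  show ?thesis
    unfolding johnson_graph_def V_def[symmetric]
  proof (rule geodesicI, goal_cases)
    case 1
    show ?case using parcs_graph_on_subset by simp
  next
    case (2 A B)
    then show ?case using card_Int_eq_iff[OF J, of A B] card_Int_le[OF J, of A B] by auto
  next
    case (3 A B Z)
    then show ?case using card_Int_adjacent_le[OF J, of A Z B] by simp
  next
    case (4 A B l)
    then have "A \<in> V" "B \<in> V" "A \<noteq> B" using card_Int_eq_iff[OF J, of A A] by auto
    then obtain Z where "Z \<in> V" "card (A \<inter> Z) + 1 = k" "card (Z \<inter> B) = card (A \<inter> B) + 1"
      using johnson_step[OF J] by blast
    then show ?case using 4 by (intro exI[of _ Z]) auto
  qed
qed

text \<open>With \<open>M\<close> the incidence matrix of sets against points,
  \<open>D = k J - M M\<^sup>T\<close> and \<open>M\<^sup>T M = (l1 - l2) I + l2 J\<close>. Hence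
  the square of \<open>M M\<^sup>T\<close> is \<open>l1 - l2\<close> times itself modulo
  \<open>J\<close>, and \<open>t = l1 - l2\<close>.\<close>

lemma quadratic_metric_johnson:
  assumes "2 \<le> k" "k < n"
  shows "\<exists>\<theta>>0. quadratic_metric {A. A \<subseteq> {0..<n} \<and> card A = k} (\<lambda>A B. k - card (A \<inter> B)) \<theta>"
proof -
  define V where "V = {A. A \<subseteq> {0..<n} \<and> card A = k}"
  note J = V_def
  let ?l1 = "real ((n - 1) choose (k - 1))" and ?l2 = "real ((n - 2) choose (k - 2))"
  \<comment> \<open>By Pascal's rule \<open>?l1 - ?l2\<close> is
    \<open>(n - 2) choose (k - 1)\<close>, which is positive because \<open>k < n\<close>.\<close>
  have "(n - 1) choose (k - 1) = ((n - 2) choose (k - 1)) + ((n - 2) choose (k - 2))"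
    using assms binomial_Suc_Suc[of "n - 2" "k - 2"] by (simp add: Suc_diff_Suc numeral_2_eq_2)
  moreover have "((n - 2) choose (k - 1)) > 0" using assms by simp
  ultimately have l: "?l1 - ?l2 > 0" by simp
  have "card V > 0" using assms n_subsets[of "{0..<n}" k] by (simp add: V_def)
  then have cancel: "x / card V * card V = x" for x :: real by simp
  have dist: "real (k - card (A \<inter> B)) = real k - real (card (A \<inter> B))" if "A \<in> V" for A B
    using card_Int_le[OF J that] by (simp add: of_nat_diff)
  have dist': "real (k - card (A \<inter> B)) = real k - real (card (A \<inter> B))" if "B \<in> V" for A B
    using dist[OF that, of A] by (simp add: Int_commute)
  have row: "(\<Sum>C\<in>V. real (card (C \<inter> A))) = k * ?l1" if "A \<in> V" for A
    using sum_card_Int[OF J that assms(1)] by (simp add: Int_commute)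
  have "quadratic_metric V (\<lambda>A B. k - card (A \<inter> B)) ((?l1 - ?l2) / card V)"
  proof (rule quadratic_metricI)
    show "finite V" by (rule finite_subset_family[OF J])
    show "k - card (A \<inter> B) = k - card (B \<inter> A)" for A B :: "nat set" by (simp add: Int_commute)
    show "(\<Sum>C\<in>V. real (k - card (A \<inter> C))) = card V * k - k * ?l1" if "A \<in> V" for A
      using sum_card_Int[OF J that assms(1)] dist[OF that] by (simp add: sum_subtractf)
    show "(\<Sum>C\<in>V. real (k - card (A \<inter> C)) * real (k - card (C \<inter> B)))
        = card V * k * k - 2 * k * (k * ?l1) + k * k * ?l2 + (?l1 - ?l2) * k
          - (?l1 - ?l2) / card V * card V * real (k - card (A \<inter> B))"
      if "A \<in> V" "B \<in> V" for A B
    proof -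
      have "(\<Sum>C\<in>V. real (k - card (A \<inter> C)) * real (k - card (C \<inter> B)))
        = (\<Sum>C\<in>V. real k * real k - real k * real (card (A \<inter> C)) - real k * real (card (C \<inter> B))
            + real (card (A \<inter> C)) * real (card (C \<inter> B)))"
        by (simp only: dist[OF that(1)] dist'[OF that(2)]) (simp add: algebra_simps)
      also have "\<dots> = card V * (real k * real k) - k * (k * ?l1) - k * (k * ?l1)
          + (real k * real k * ?l2 + (?l1 - ?l2) * card (A \<inter> B))"
        using sum_card_Int[OF J that(1) assms(1)] row[OF that(2)] sum_card_Int_mult[OF J that assms(1)]
        by (simp only: sum_subtractf sum.distrib sum_distrib_left[symmetric] sum_constant)
          (simp add: mult.left_commute)
      also have "\<dots> = card V * k * k - 2 * k * (k * ?l1) + k * k * ?l2 + (?l1 - ?l2) * k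
          - (?l1 - ?l2) / card V * card V * real (k - card (A \<inter> B))"
        by (simp only: dist[OF that(1)] cancel) (simp add: algebra_simps)
      finally show ?thesis .
    qed
  qed
  then show ?thesis
    using l \<open>card V > 0\<close> unfolding V_def[symmetric] by (intro exI conjI) auto
qed

section \<open>Halved cubes\<close>

lemma word_nth_less: "x \<in> words n 2 \<Longrightarrow> i < n \<Longrightarrow> x ! i < 2"
  by (auto simp: words_def subset_iff dest: nth_mem)

lemma length_word: "x \<in> words n q \<Longrightarrow> length x = n"
  by (simp add: words_def)

lemma hamming_dist_sum:
  "length x = n \<Longrightarrow> hamming_dist x y = (\<Sum>i<n. of_bool (x ! i \<noteq> y ! i))"
  by (simp add: hamming_dist_def Int_def)

lemma even_hamming_dist_iff:
  assumes "x \<in> words n 2" "y \<in> words n 2"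
  shows "even (hamming_dist x y) \<longleftrightarrow> (even (sum_list x) \<longleftrightarrow> even (sum_list y))"
proof -
  \<comment> \<open>For two binary digits each summand is 0 or 2.\<close>
  have "even (\<Sum>i<n. x ! i + y ! i + of_bool (x ! i \<noteq> y ! i))"
  proof (intro dvd_sum)
    fix i assume "i \<in> {..<n}"
    then have "x ! i = 0 \<or> x ! i = 1" "y ! i = 0 \<or> y ! i = 1"
      using word_nth_less[OF assms(1)] word_nth_less[OF assms(2)] by (auto simp: less_2_cases_iff)
    then show "even (x ! i + y ! i + of_bool (x ! i \<noteq> y ! i))" by auto
  qed
  then have "even (sum_list x + sum_list y + hamming_dist x y)"
    using assms by (simp add: sum.distrib hamming_dist_sum length_word sum_list_sum_nth lessThan_atLeast0)
  then show ?thesis by auto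
qed

lemma hamming_dist_triangle:
  assumes "length x = n" "length z = n"
  shows "hamming_dist x y \<le> hamming_dist x z + hamming_dist z y"
proof -
  have "card {i. i < n \<and> x ! i \<noteq> y ! i} \<le> card ({i. i < n \<and> x ! i \<noteq> z ! i} \<union> {i. i < n \<and> z ! i \<noteq> y ! i})"
    by (intro card_mono) auto
  then show ?thesis
    using card_Un_le[of "{i. i < n \<and> x ! i \<noteq> z ! i}" "{i. i < n \<and> z ! i \<noteq> y ! i}"] assms
    by (simp add: hamming_dist_def)
qed

lemma hamming_dist_eq_0_iff:
  assumes "length x = n" "length y = n"
  shows "hamming_dist x y = 0 \<longleftrightarrow> x = y"
  using assms by (auto simp: hamming_dist_def list_eq_iff_nth_eq)

definition even_words :: "nat \<Rightarrow> nat list set" where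
  "even_words n = {x \<in> words n 2. even (sum_list x)}"

lemma even_wordsD:
  assumes "x \<in> even_words n"
  shows "x \<in> words n 2" "length x = n" "even (sum_list x)"
  using assms by (auto simp: even_words_def words_def)

lemma even_hamming_dist:
  "x \<in> even_words n \<Longrightarrow> y \<in> even_words n \<Longrightarrow> even (hamming_dist x y)"
  using even_hamming_dist_iff by (auto simp: even_words_def)

lemma list_update_word:
  "x \<in> words n q \<Longrightarrow> a < q \<Longrightarrow> x[i := a] \<in> words n q"
  using set_update_subset_insert[of x i a] by (auto simp: words_def)

text \<open>The parity of the new word is read off from its even distance to \<open>x\<close>, with
  no computation of its digit sum.\<close>

lemma even_words_update2:
  assumes x: "x \<in> even_words n" and ij: "i < n" "j < n" "i \<noteq> j"
    and ab: "a < 2" "b < 2" "x ! i \<noteq> a" "x ! j \<noteq> b"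
  shows "x[i := a, j := b] \<in> even_words n" "hamming_dist x (x[i := a, j := b]) = 2"
proof -
  let ?y = "x[i := a, j := b]"
  note X = even_wordsD[OF x]
  have "{l. l < n \<and> x ! l \<noteq> ?y ! l} = {i, j}"
    using X(2) ij ab by (auto simp: nth_list_update split: if_splits)
  then show dist: "hamming_dist x ?y = 2" using X(2) ij by (simp add: hamming_dist_def)
  have "?y \<in> words n 2" using X(1) ab by (intro list_update_word)
  then show "?y \<in> even_words n"
    using even_hamming_dist_iff[OF X(1), of ?y] X(3) dist by (simp add: even_words_def)
qed

text \<open>Distances between even words are even, so halving is exact and a differing position
  always comes with a second one. Correcting both is one step towards the target.\<close>

lemma geodesic_halved_cube: "geodesic (halved_cube n) (\<lambda>x y. hamming_dist x y div 2)"
  unfolding halved_cube_def even_words_def[symmetric]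
proof (rule geodesicI, goal_cases)
  case 1
  show ?case using parcs_graph_on_subset by simp
next
  case (2 x y)
  then show ?case
    using even_hamming_dist[of x n y] hamming_dist_eq_0_iff[of x n y]
    by (auto simp: even_wordsD(2) elim!: evenE)
next
  case (3 x y z)
  then show ?case
    using hamming_dist_triangle[of x n z y] by (auto simp: even_wordsD(2))
next
  case (4 x y k)
  then have V: "x \<in> even_words n" "y \<in> even_words n" by auto
  let ?D = "{l. l < n \<and> x ! l \<noteq> y ! l}"
  have h: "card ?D = 2 * Suc k"
    using even_hamming_dist[OF V] 4(3) even_wordsD(2)[OF V(1)] by (auto simp: hamming_dist_def elim!: evenE)
  then have "?D \<noteq> {}" by (metis card.empty nat.distinct(1) mult_is_0 zero_neq_numeral)
  then obtain i where i: "i \<in> ?D" by blast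
  then have "card (?D - {i}) = Suc (2 * k)" using h by simp
  then have "?D - {i} \<noteq> {}" by (metis card.empty nat.distinct(1))
  then obtain j where j: "j \<in> ?D" "j \<noteq> i" by blast
  let ?z = "x[i := y ! i, j := y ! j]"
  have z: "?z \<in> even_words n" "hamming_dist x ?z = 2"
    using even_words_update2[OF V(1), of i j "y ! i" "y ! j"] i j word_nth_less[OF even_wordsD(1)[OF V(2)]]
    by auto
  have "{l. l < n \<and> ?z ! l \<noteq> y ! l} = ?D - {i, j}"
    using i j even_wordsD(2)[OF V(1)] by (auto simp: nth_list_update split: if_splits)
  moreover have "card (?D - {i, j}) = 2 * k"
    using h i j by (subst card_Diff_subset) auto
  ultimately have "hamming_dist ?z y = 2 * k"
    using even_wordsD(2)[OF V(1)] by (simp add: hamming_dist_def)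
  then show ?case using z V by (intro exI[of _ ?z]) auto
qed

text \<open>
  Flipping a coordinate that occurs in a product of at most two coordinate characters together with
  one that does not is an involution of the even words that changes the sign of the product. The
  second coordinate exists because \<open>n \<ge> 3\<close>.
\<close>

definition coord_sign :: "nat list \<Rightarrow> nat \<Rightarrow> real" where
  "coord_sign x i = (if x ! i = 0 then 1 else - 1)"

lemma sum_even_words_eq_0:
  fixes g :: "nat list \<Rightarrow> real"
  assumes ij: "i < n" "j < n" "i \<noteq> j"
    and neg: "\<And>x. x \<in> even_words n \<Longrightarrow> g (x[i := 1 - x ! i, j := 1 - x ! j]) = - g x"
  shows "(\<Sum>x\<in>even_words n. g x) = 0"
proof -
  let ?\<tau> = "\<lambda>x :: nat list. x[i := 1 - x ! i, j := 1 - x ! j]"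
  have mem: "?\<tau> x \<in> even_words n" and inv: "?\<tau> (?\<tau> x) = x" if "x \<in> even_words n" for x
  proof -
    note X = even_wordsD[OF that]
    have "x ! i < 2" "x ! j < 2" using word_nth_less[OF X(1)] ij by auto
    then have "1 - x ! i < 2" "1 - x ! j < 2" "x ! i \<noteq> 1 - x ! i" "x ! j \<noteq> 1 - x ! j"
      by arith+
    then show "?\<tau> x \<in> even_words n"
      by (rule even_words_update2(1)[OF that ij])
    show "?\<tau> (?\<tau> x) = x"
      using X(2) ij \<open>x ! i < 2\<close> \<open>x ! j < 2\<close>
      by (auto simp: list_eq_iff_nth_eq nth_list_update less_2_cases_iff)
  qed
  have "(\<Sum>x\<in>even_words n. g x) = (\<Sum>x\<in>even_words n. g (?\<tau> x))"
    by (rule sum.reindex_bij_witness[of _ ?\<tau> ?\<tau>]) (use mem inv in simp_all)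
  also have "\<dots> = (\<Sum>x\<in>even_words n. - g x)" using neg by (rule sum.cong[OF refl])
  finally show ?thesis by (simp add: sum_negf)
qed

lemma coord_sign_flip:
  assumes "x \<in> even_words n" "i < n" "j < n" "l < n"
  shows "coord_sign (x[i := 1 - x ! i, j := 1 - x ! j]) l = (if l = i \<or> l = j then - 1 else 1) * coord_sign x l"
  using assms word_nth_less[OF even_wordsD(1)[OF assms(1)]] even_wordsD(2)[OF assms(1)]
  by (auto simp: coord_sign_def nth_list_update less_2_cases_iff)

lemma sum_coord_sign:
  assumes "n \<ge> 2" "i < n"
  shows "(\<Sum>x\<in>even_words n. coord_sign x i) = 0"
proof -
  obtain k where "k < n" "k \<noteq> i"
    using assms by (metis One_nat_def Suc_1 Suc_le_eq less_trans zero_less_Suc zero_neq_one)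
  then show ?thesis
    using assms by (intro sum_even_words_eq_0[of i n k]) (auto simp: coord_sign_flip simp del: One_nat_def)
qed

lemma sum_coord_sign_mult:
  assumes "n \<ge> 3" "i < n" "j < n"
  shows "(\<Sum>x\<in>even_words n. coord_sign x i * coord_sign x j) = of_bool (i = j) * card (even_words n)"
proof (cases "i = j")
  case True
  then show ?thesis by (simp add: coord_sign_def if_distrib cong: if_cong)
next
  case False
  have "card ({..<n} - {i, j}) = n - 2"
    using assms False by (subst card_Diff_subset) auto
  then have "{..<n} - {i, j} \<noteq> {}" using assms by (metis card.empty diff_is_0_eq not_less_eq_eq numeral_2_eq_2 numeral_3_eq_3)
  then obtain k where "k < n" "k \<noteq> i" "k \<noteq> j" by auto
  then show ?thesis
    using assms False
    by (simp, intro sum_even_words_eq_0[of i n k]) (auto simp: coord_sign_flip simp del: One_nat_def)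
qed

lemma finite_even_words: "finite (even_words n)"
  using finite_lists_length_eq[of "{0..<2::nat}" n]
  by (rule rev_finite_subset) (auto simp: even_words_def words_def)

text \<open>A coordinate contributes \<open>(1 - s t) / 2\<close> for its signs \<open>s\<close> and
  \<open>t\<close>; halving the distance turns the denominator into 4. Thus the distance is affine
  in the inner product of sign vectors.\<close>

lemma hamming_dist_coord_sign:
  assumes "x \<in> even_words n" "y \<in> even_words n"
  shows "real (hamming_dist x y div 2) = (n - (\<Sum>i<n. coord_sign x i * coord_sign y i)) / 4"
proof -
  have "real (hamming_dist x y) = (\<Sum>i<n. of_bool (x ! i \<noteq> y ! i))"
    using hamming_dist_sum[OF even_wordsD(2)[OF assms(1)], of y] by simp
  also have "\<dots> = (\<Sum>i<n. (1 - coord_sign x i * coord_sign y i) / 2)"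
  proof (intro sum.cong refl)
    fix i assume "i \<in> {..<n}"
    then have "x ! i < 2" "y ! i < 2"
      using word_nth_less[OF even_wordsD(1)[OF assms(1)]] word_nth_less[OF even_wordsD(1)[OF assms(2)]]
      by auto
    then show "of_bool (x ! i \<noteq> y ! i) = (1 - coord_sign x i * coord_sign y i) / 2"
      by (auto simp: coord_sign_def less_2_cases_iff)
  qed
  also have "\<dots> = (n - (\<Sum>i<n. coord_sign x i * coord_sign y i)) / 2"
    by (simp add: sum_subtractf flip: sum_divide_distrib)
  finally show ?thesis
    using even_hamming_dist[OF assms] by (simp add: real_of_nat_div)
qed

text \<open>In matrix form \<open>D = (n J - S) / 4\<close> with \<open>S\<close> the Gram matrix of
  the sign vectors, \<open>S J = 0\<close> and \<open>S\<^sup>2 = N S\<close>. Substituting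
  \<open>S = n J - 4 D\<close> into \<open>D\<^sup>2 = (n\<^sup>2 N J + N S) / 16\<close> yields
  both constants.\<close>

lemma quadratic_metric_halved_cube:
  assumes "n \<ge> 3"
  shows "quadratic_metric (even_words n) (\<lambda>x y. hamming_dist x y div 2) (1 / 4)"
proof -
  let ?V = "even_words n" and ?N = "real (card (even_words n))"
  define S where "S x y = (\<Sum>i<n. coord_sign x i * coord_sign y i)" for x y
  have dist: "real (hamming_dist x y div 2) = (n - S x y) / 4" if "x \<in> ?V" "y \<in> ?V" for x y
    using hamming_dist_coord_sign[OF that] by (simp add: S_def)
  have sym: "S x y = S y x" for x y by (simp add: S_def mult.commute)
  have "(\<Sum>z\<in>?V. S x z) = (\<Sum>i<n. coord_sign x i * (\<Sum>z\<in>?V. coord_sign z i))" for x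
    unfolding S_def by (subst sum.swap) (simp add: sum_distrib_left)
  then have row: "(\<Sum>z\<in>?V. S x z) = 0" for x using assms sum_coord_sign by simp
  have square: "(\<Sum>z\<in>?V. S x z * S z y) = ?N * S x y" for x y
  proof -
    have "(\<Sum>z\<in>?V. S x z * S z y)
        = (\<Sum>z\<in>?V. \<Sum>i<n. \<Sum>j<n. coord_sign x i * coord_sign y j * (coord_sign z i * coord_sign z j))"
      unfolding S_def sum_product by (simp add: mult_ac)
    also have "\<dots> = (\<Sum>i<n. \<Sum>z\<in>?V. \<Sum>j<n. coord_sign x i * coord_sign y j * (coord_sign z i * coord_sign z j))"
      by (rule sum.swap)
    also have "\<dots> = (\<Sum>i<n. \<Sum>j<n. \<Sum>z\<in>?V. coord_sign x i * coord_sign y j * (coord_sign z i * coord_sign z j))"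
      by (intro sum.cong refl sum.swap)
    also have "\<dots> = (\<Sum>i<n. \<Sum>j<n. coord_sign x i * coord_sign y j * (of_bool (i = j) * ?N))"
      using sum_coord_sign_mult[OF assms] by (simp flip: sum_distrib_left)
    also have "\<dots> = (\<Sum>i<n. coord_sign x i * coord_sign y i * ?N)"
      by (intro sum.cong refl) (simp add: of_bool_def if_distrib if_distribR cong: if_cong)
    also have "\<dots> = ?N * S x y" by (simp add: S_def sum_distrib_left mult_ac)
    finally show ?thesis .
  qed
  show ?thesis
  proof (rule quadratic_metricI)
    show "finite ?V" by (rule finite_even_words)
    show "hamming_dist x y div 2 = hamming_dist y x div 2" if "x \<in> ?V" "y \<in> ?V" for x y
      using even_wordsD(2)[OF that(1)] even_wordsD(2)[OF that(2)]
      by (simp add: hamming_dist_def eq_commute[of "x ! _"])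
    show "(\<Sum>z\<in>?V. real (hamming_dist x z div 2)) = ?N * n / 4" if "x \<in> ?V" for x
    proof -
      have "(\<Sum>z\<in>?V. real (hamming_dist x z div 2)) = (\<Sum>z\<in>?V. (n - S x z) / 4)"
        using dist that by (intro sum.cong refl)
      then show ?thesis
        using row[of x] by (simp add: sum_subtractf flip: sum_divide_distrib)
    qed
    show "(\<Sum>z\<in>?V. real (hamming_dist x z div 2) * real (hamming_dist z y div 2))
        = ?N * (n * n + n) / 16 - 1 / 4 * ?N * real (hamming_dist x y div 2)"
      if "x \<in> ?V" "y \<in> ?V" for x y
    proof -
      have "(\<Sum>z\<in>?V. real (hamming_dist x z div 2) * real (hamming_dist z y div 2))
        = (\<Sum>z\<in>?V. (real n * real n - real n * S x z - real n * S y z + S x z * S z y) / 16)"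
        using that by (intro sum.cong refl) (simp add: dist, simp add: sym[of y] algebra_simps)
      also have "\<dots> = (real n * (?N * real n) - real n * 0 - real n * 0 + ?N * S x y) / 16"
        by (simp only: sum_divide_distrib[symmetric] sum.distrib sum_subtractf
            sum_distrib_left[symmetric] row square sum_constant)
      also have "\<dots> = ?N * (n * n + n) / 16 - 1 / 4 * ?N * real (hamming_dist x y div 2)"
        by (simp only: dist[OF that]) (simp add: field_simps)
      finally show ?thesis .
    qed
  qed
qed

section \<open>The Gosset graph\<close>

text \<open>In the coordinates of length 8 this is 24 minus the inner product, divided by 16. The
  two branches add up to 3, since the same edge in the other copy is the antipode.\<close>

fun gosset_dist :: "bool \<times> nat set \<Rightarrow> bool \<times> nat set \<Rightarrow> nat" where
  "gosset_dist (s, e) (t, f) = (if s = t then 2 - card (e \<inter> f) else 1 + card (e \<inter> f))"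

context
  fixes E :: "nat set set"
  assumes E: "E = {e. e \<subseteq> {0..<8} \<and> card e = 2}"
begin

lemma geodesic_gosset_graph: "geodesic gosset_graph gosset_dist"
  unfolding gosset_graph_def E[symmetric]
proof (rule geodesicI, goal_cases)
  case 1
  show ?case using parcs_graph_on_subset by simp
next
  case (2 p q)
  then obtain s e t f where "p = (s, e)" "e \<in> E" "q = (t, f)" "f \<in> E"
    by (cases p; cases q) auto
  then show ?case
    using card_Int_eq_iff[OF E, of e f] card_Int_le[OF E, of e f] by auto
next
  case (3 p q r)
  then obtain s e t f u g where p: "p = (s, e)" "e \<in> E" and q: "q = (t, f)" "f \<in> E"
    and r: "r = (u, g)" "g \<in> E" and adj: "if s = u then card (e \<inter> g) = 1 else e \<inter> g = {}"
    by (cases p; cases q; cases r) auto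
  show ?case
  proof (cases "s = u")
    case True
    then have "card (g \<inter> f) \<le> card (e \<inter> f) + 1" "card (e \<inter> f) \<le> card (g \<inter> f) + 1"
      using card_Int_adjacent_le[OF E, of e g f] card_Int_adjacent_le[OF E, of g e f]
        adj p r by (auto simp: Int_commute)
    then show ?thesis using p q r True by auto
  next
    case False
    \<comment> \<open>The critical case is \<open>t = u\<close>, where the claim says that the
      disjoint edges \<open>e\<close> and \<open>g\<close> together cover at most the two points of
      \<open>f\<close>.\<close>
    have "card (e \<inter> f) + card (g \<inter> f) = card ((e \<inter> f) \<union> (g \<inter> f))"
      using False adj p r subset_family_finite[OF E] by (subst card_Un_disjoint) auto
    also have "\<dots> \<le> card f"
      using subset_family_finite[OF E q(2)] by (intro card_mono) auto
    finally have "card (e \<inter> f) + card (g \<inter> f) \<le> 2" using q by (simp add: E)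
    then show ?thesis using p q r False by auto
  qed
next
  case (4 p q k)
  then obtain s e t f where p: "p = (s, e)" "e \<in> E" and q: "q = (t, f)" "f \<in> E"
    by (cases p; cases q) auto
  have fin: "finite e" "finite f" and ce: "card e = 2"
    using subset_family_finite[OF E p(2)] subset_family_finite[OF E q(2)] p(2) by (simp_all add: E)
  consider "s = t" | "s \<noteq> t" "e \<inter> f = {}" | "s \<noteq> t" "e \<inter> f \<noteq> {}" by blast
  then show ?case
  proof cases
    case 1
    then have "card (e \<inter> f) < 2" using 4 p q by simp
    then have "e \<noteq> f" using ce by auto
    then obtain g where "g \<in> E" "card (e \<inter> g) + 1 = 2" "card (g \<inter> f) = card (e \<inter> f) + 1"
      using johnson_step[OF E p(2) q(2)] by blast
    then show ?thesis using 1 4 p q by (intro exI[of _ "(s, g)"]) auto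
  next
    case 2
    then show ?thesis using 4 p q by (intro exI[of _ q]) (auto simp: E)
  next
    case 3
    then obtain a where a: "a \<in> e" "a \<in> f" by blast
    \<comment> \<open>Staying in the same copy, a common point is exchanged for one outside both
      edges, which exists because they cover at most 4 of the 8 points.\<close>
    have "card (e \<union> f) \<le> 4" using card_Un_le[of e f] p q by (simp add: E)
    then have "\<not> {0..<8} \<subseteq> e \<union> f"
      using card_mono[of "e \<union> f" "{0..<8}"] fin by auto
    then obtain b where b: "b \<in> {0..<8}" "b \<notin> e" "b \<notin> f" by blast
    note g = johnson_exchange[OF E p(2) a(1) b(1,2)]
    have "insert b (e - {a}) \<inter> f = (e \<inter> f) - {a}" using b by auto
    then have "card (insert b (e - {a}) \<inter> f) + 1 = card (e \<inter> f)"
      using a fin by (metis IntI Suc_eq_plus1 card_Suc_Diff1 finite_Int)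
    then show ?thesis
      using 3 4 p q g by (intro exI[of _ "(s, insert b (e - {a}))"]) auto
  qed
qed

text \<open>Each of the 28 antipodal pairs contributes 3 to a row sum, giving 84. With
  \<open>t = 12\<close> and 56 vertices, \<open>\<theta> = 12 / 56\<close> and
  \<open>c = 84 * 96 / 56 = 144\<close>.\<close>

lemma quadratic_metric_gosset: "quadratic_metric (UNIV \<times> E) gosset_dist (3 / 14)"
proof (rule quadratic_metricI[where r = 84 and c = 144])
  have cE: "card E = 28" using n_subsets[of "{0..<8::nat}" 2] by (simp add: E choose_two)
  have fin: "finite E" by (rule finite_subset_family[OF E])
  then show "finite (UNIV \<times> E :: (bool \<times> nat set) set)" by simp
  show "gosset_dist p q = gosset_dist q p" for p q
    by (cases p; cases q) (auto simp: Int_commute)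
  have row: "(\<Sum>g\<in>E. real (card (e \<inter> g))) = 14" "(\<Sum>g\<in>E. real (card (g \<inter> e))) = 14" if "e \<in> E" for e
    using sum_card_Int[OF E that order.refl] by (simp_all add: Int_commute)
  have square: "(\<Sum>g\<in>E. real (card (e \<inter> g)) * real (card (g \<inter> f))) = 4 + 6 * card (e \<inter> f)"
    if "e \<in> E" "f \<in> E" for e f
    using sum_card_Int_mult[OF E that order.refl] by simp
  have two: "real (2 - card (e \<inter> g)) = 2 - real (card (e \<inter> g))"
    "real (2 - card (g \<inter> e)) = 2 - real (card (g \<inter> e))" if "e \<in> E" for e g
    using card_Int_le[OF E that, of g] by (simp_all add: of_nat_diff Int_commute)
  \<comment> \<open>Groups the vertices into antipodal pairs, listing first the copy that contains
    \<open>p\<close>, so that everything reduces to sums over the edges.\<close>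
  have sum_bool: "(\<Sum>z\<in>UNIV \<times> E. h z) = (\<Sum>g\<in>E. h (s, g) + h (\<not> s, g))" for h :: "bool \<times> nat set \<Rightarrow> real" and s
  proof -
    have "(\<Sum>z\<in>UNIV \<times> E. h z) = (\<Sum>u\<in>UNIV. \<Sum>g\<in>E. h (u, g))"
      by (simp add: sum.cartesian_product)
    then show ?thesis by (cases s) (simp_all add: UNIV_bool sum.distrib)
  qed
  show "(\<Sum>z\<in>UNIV \<times> E. real (gosset_dist p z)) = 84" if pE: "p \<in> UNIV \<times> E" for p
  proof -
    obtain s e where p: "p = (s, e)" "e \<in> E" using pE by auto
    have "(\<Sum>z\<in>UNIV \<times> E. real (gosset_dist p z)) = (\<Sum>g\<in>E. 3)"
      unfolding sum_bool[of _ s] using p two by (intro sum.cong refl) simp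
    then show ?thesis using cE by simp
  qed
  show "(\<Sum>z\<in>UNIV \<times> E. real (gosset_dist p z) * real (gosset_dist z q))
      = 144 - 3 / 14 * card (UNIV \<times> E :: (bool \<times> nat set) set) * gosset_dist p q"
    if pq: "p \<in> UNIV \<times> E" "q \<in> UNIV \<times> E" for p q
  proof -
    obtain s e t f where p: "p = (s, e)" "e \<in> E" and q: "q = (t, f)" "f \<in> E" using pq by auto
    let ?c = "\<lambda>e f. real (card (e \<inter> f))"
    have card: "3 / 14 * real (card (UNIV \<times> E :: (bool \<times> nat set) set)) = 12"
      using cE by (simp add: card_cartesian_product)
    show ?thesis
    proof (cases "s = t")
      case True
      have "(\<Sum>z\<in>UNIV \<times> E. real (gosset_dist p z) * real (gosset_dist z q))
        = (\<Sum>g\<in>E. 5 - ?c e g - ?c g f + 2 * (?c e g * ?c g f))"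
        unfolding sum_bool[of _ s] using p q True
        by (intro sum.cong refl) (simp add: two, simp add: algebra_simps)
      also have "\<dots> = 144 - 12 * (2 - ?c e f)"
        using cE row(1)[OF p(2)] row(2)[OF q(2)] square[OF p(2) q(2)]
        by (simp only: sum_subtractf sum.distrib sum_distrib_left[symmetric] sum_constant) simp
      finally show ?thesis unfolding card using True p q two by simp
    next
      case False
      then have t: "t = (\<not> s)" by auto
      have "(\<Sum>z\<in>UNIV \<times> E. real (gosset_dist p z) * real (gosset_dist z q))
        = (\<Sum>g\<in>E. 4 + ?c e g + ?c g f - 2 * (?c e g * ?c g f))"
        unfolding sum_bool[of _ s] using p q t
        by (intro sum.cong refl) (simp add: two, simp add: algebra_simps)
      also have "\<dots> = 144 - 12 * (1 + ?c e f)"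
        using cE row(1)[OF p(2)] row(2)[OF q(2)] square[OF p(2) q(2)]
        by (simp only: sum_subtractf sum.distrib sum_distrib_left[symmetric] sum_constant) simp
      finally show ?thesis unfolding card using False p q by simp
    qed
  qed
qed

end

section \<open>The spectrum\<close>

text \<open>The quadratic relation is requested only in the presence of two vertices at distance at
  least 3. The diameter supplies such a pair, and in the models it rules out an empty alphabet,
  \<open>k < 2\<close>, \<open>k \<ge> n\<close> and cubes of dimension below 3.\<close>

lemma spectrum_of_model:
  fixes G :: "'a pair_pre_digraph" and H :: "'b pair_pre_digraph"
  assumes V: "finite (pverts G)" "pverts G \<noteq> {}" and diam: "graph_diameter G \<ge> 3"
    and iso: "graph_iso G H" and f: "geodesic H f"
    and quad: "\<And>x y. x \<in> pverts H \<Longrightarrow> y \<in> pverts H \<Longrightarrow> f x y \<ge> 3 \<Longrightarrow>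
      \<exists>\<theta>>0. quadratic_metric (pverts H) f \<theta>"
    and vs: "distinct vs" "set vs = pverts G"
  shows "card (spectrum (distance_matrix G vs)) = 3 \<and> 0 \<in> spectrum (distance_matrix G vs)"
proof -
  obtain \<phi> where bij: "bij_betw \<phi> (pverts G) (pverts H)"
    and arcs: "\<And>x y. x \<in> pverts G \<Longrightarrow> y \<in> pverts G \<Longrightarrow> (x, y) \<in> parcs G \<longleftrightarrow> (\<phi> x, \<phi> y) \<in> parcs H"
    and sub: "parcs G \<subseteq> pverts G \<times> pverts G"
    using graph_iso_bij[OF iso] by blast
  note g = geodesic_iso[OF f bij arcs sub]
  note dist = geodesic_graph_dist[OF g]
  have in_H: "\<phi> x \<in> pverts H" if "x \<in> pverts G" for x
    using bij that by (auto simp: bij_betw_def)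
  let ?D = "{graph_dist G u v | u v. u \<in> pverts G \<and> v \<in> pverts G}"
  have "?D = (\<lambda>(u, v). graph_dist G u v) ` (pverts G \<times> pverts G)" by auto
  then have "Max ?D \<in> ?D" using V by (intro Max_in) auto
  then obtain u v where uv: "u \<in> pverts G" "v \<in> pverts G" and "graph_dist G u v \<ge> 3"
    using diam unfolding graph_diameter_def by force
  then have far: "f (\<phi> u) (\<phi> v) \<ge> 3" using dist by simp
  then obtain \<theta> where \<theta>: "\<theta> > 0" "quadratic_metric (pverts H) f \<theta>"
    using quad in_H uv by blast
  have q: "quadratic_metric (set vs) (graph_dist G) \<theta>"
    unfolding vs using quadratic_metric_bij[OF \<theta>(2) bij] dist by blast
  \<comment> \<open>The first vertex \<open>w\<close> on a shortest walk from \<open>u\<close> to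
    \<open>v\<close> is at distance 1 from \<open>u\<close>, whereas \<open>v\<close> is at distance
    at least 3: these are the two distances that the spectral argument requires.\<close>
  obtain k where k: "f (\<phi> u) (\<phi> v) = Suc k" using far by (cases "f (\<phi> u) (\<phi> v)") auto
  then obtain w where w: "(u, w) \<in> parcs G" "f (\<phi> w) (\<phi> v) = k"
    using geodesicD(4)[OF g uv] by blast
  then have wV: "w \<in> pverts G" using sub by auto
  have "f (\<phi> u) (\<phi> w) \<le> 1"
    using geodesicD(3)[OF g wV w(1)] geodesicD(2)[OF g wV wV] by simp
  moreover have "u \<noteq> w" using k w by auto
  moreover have "u \<noteq> v" using geodesicD(2)[OF g uv] k by auto
  ultimately show ?thesis
    using far uv wV dist geodesicD(2)[OF g] vs
    by (intro spectrum_distance_matrix[OF q \<theta>(1) vs(1), of u w v]) auto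
qed

theorem theorem4p7:
  fixes G :: "'a pair_pre_digraph" and vs :: "'a list"
  assumes "distance_regular G"
    and "graph_diameter G \<ge> 3"
    and "(is_hamming_graph G \<or> is_doob_graph G) \<or> is_johnson_graph G \<or> is_halved_cube G
         \<or> is_gosset_graph G"
    and "distinct vs" and "set vs = pverts G"
  shows "card (spectrum (distance_matrix G vs)) = 3 \<and> 0 \<in> spectrum (distance_matrix G vs)"
proof -
  have conn: "Digraph_Component.connected (with_proj G)"
    using assms(1) by (simp add: distance_regular_def)
  have fin: "finite (pverts G)" using assms(5) by (metis List.finite_set)
  \<comment> \<open>Connectedness includes having a vertex, so the maximum defining the diameter is
    attained.\<close>
  have ne: "pverts G \<noteq> {}"
    using conn by (simp add: connected_def strongly_connected_def mk_symmetric_def)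
  note spec = spectrum_of_model[OF fin ne assms(2) _ _ _ assms(4,5)]
  consider d q where "graph_iso G (hamming_graph d q)" | n m where "graph_iso G (doob_graph n m)"
    | n k where "graph_iso G (johnson_graph n k)" | n where "graph_iso G (halved_cube n)"
    | "graph_iso G gosset_graph"
    using assms(3)
    by (auto simp: is_hamming_graph_def is_doob_graph_def is_johnson_graph_def is_halved_cube_def
        is_gosset_graph_def)
  then show ?thesis
  proof cases
    case 1
    show ?thesis
    proof (rule spec[OF 1])
      let ?f = "list_metric (\<lambda>x y :: nat. if x = y then 0 else 1)"
      show "geodesic (hamming_graph d q) ?f"
        unfolding hamming_graph_eq_power by (intro geodesic_cartesian_power geodesic_complete_graph)
      fix x y assume xy: "x \<in> pverts (hamming_graph d q)" "?f x y \<ge> 3"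
      have "q > 0"
      proof (rule ccontr)
        assume "\<not> q > 0"
        then have "x = []" using xy(1) by (simp add: hamming_graph_def words_def)
        then show False using xy(2) by (simp add: list_metric_def)
      qed
      moreover have "pverts (hamming_graph d q) = {xs. length xs = d \<and> set xs \<subseteq> {0..<q}}"
        by (simp add: hamming_graph_def words_def)
      ultimately show "\<exists>\<theta>>0. quadratic_metric (pverts (hamming_graph d q)) ?f \<theta>"
        using quadratic_metric_power[OF quadratic_metric_complete_graph, of q d]
        by (intro exI[of _ "1 / real q"]) simp
    qed
  next
    case 2
    let ?k4 = "\<lambda>x y :: nat. if x = y then 0 else 1"
    let ?f = "\<lambda>(x, u) (y, v). list_metric shrikhande_dist x y + list_metric ?k4 u v"
    show ?thesis
    proof (rule spec[OF 2])
      show "geodesic (doob_graph n m) ?f"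
        unfolding doob_graph_def
        by (intro geodesic_cartesian_product geodesic_cartesian_power geodesic_shrikhande_graph
            geodesic_complete_graph)
      have "pverts (doob_graph n m) =
          {xs. length xs = n \<and> set xs \<subseteq> {0..<4} \<times> {0..<4}} \<times> {xs. length xs = m \<and> set xs \<subseteq> {0..<4}}"
        by (simp add: doob_graph_def cartesian_product_def cartesian_power_def shrikhande_graph_def
            complete_graph_def)
      \<comment> \<open>For \<open>q = 4\<close> the ratio \<open>1 / q\<close> agrees with that of
        the Shrikhande graph, as the product requires.\<close>
      moreover have "quadratic_metric {0..<4} ?k4 (1 / 4)"
        using quadratic_metric_complete_graph[of 4] by simp
      ultimately show "\<exists>\<theta>>0. quadratic_metric (pverts (doob_graph n m)) ?f \<theta>"
        by (auto intro!: exI[of _ "1 / 4"] quadratic_metric_prod quadratic_metric_power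
            quadratic_metric_shrikhande simp del: mem_Collect_eq)
    qed
  next
    case 3
    have V: "pverts (johnson_graph n k) = {A. A \<subseteq> {0..<n} \<and> card A = k}"
      by (simp add: johnson_graph_def)
    show ?thesis
    proof (rule spec[OF 3 geodesic_johnson_graph], unfold V)
      fix A B assume A: "A \<in> {A. A \<subseteq> {0..<n} \<and> card A = k}"
        and B: "B \<in> {A. A \<subseteq> {0..<n} \<and> card A = k}" and far: "3 \<le> k - card (A \<inter> B)"
      \<comment> \<open>Otherwise the full set would be the only possible vertex, leaving no
        positive distance.\<close>
      have "k < n"
      proof (rule ccontr)
        assume "\<not> k < n"
        then have "A = {0..<n}" "B = {0..<n}"
          using A B card_seteq[of "{0..<n}" A] card_seteq[of "{0..<n}" B] by auto
        then show False using far A by simp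
      qed
      then show "\<exists>\<theta>>0. quadratic_metric {A. A \<subseteq> {0..<n} \<and> card A = k} (\<lambda>A B. k - card (A \<inter> B)) \<theta>"
        using far by (intro quadratic_metric_johnson) auto
    qed
  next
    case 4
    have V: "pverts (halved_cube n) = even_words n"
      by (simp add: halved_cube_def even_words_def)
    show ?thesis
    proof (rule spec[OF 4 geodesic_halved_cube], unfold V)
      fix x y assume "x \<in> even_words n" "3 \<le> hamming_dist x y div 2"
      \<comment> \<open>A halved distance of at least 3 means at least 6 differing positions, which
        forces \<open>n\<close> to be large enough.\<close>
      moreover have "hamming_dist x y \<le> n"
        using card_mono[of "{..<n}" "{i. i < n \<and> x ! i \<noteq> y ! i}"] even_wordsD(2)[OF \<open>x \<in> even_words n\<close>]
        by (auto simp: hamming_dist_def)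
      ultimately have "n \<ge> 3" by simp
      then show "\<exists>\<theta>>0. quadratic_metric (even_words n) (\<lambda>x y. hamming_dist x y div 2) \<theta>"
        using quadratic_metric_halved_cube by (intro exI[of _ "1 / 4"]) simp
    qed
  next
    case 5
    have V: "pverts gosset_graph = UNIV \<times> {e. e \<subseteq> {0..<8} \<and> card e = 2}"
      by (simp add: gosset_graph_def)
    show ?thesis
    proof (rule spec[OF 5 geodesic_gosset_graph[OF refl]], unfold V)
      show "\<exists>\<theta>>0. quadratic_metric (UNIV \<times> {e. e \<subseteq> {0..<8} \<and> card e = 2}) gosset_dist \<theta>"
        using quadratic_metric_gosset[OF refl] by (intro exI[of _ "3 / 14"]) simp
    qed
  qed
qed

end
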